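(* For integers $m\ge0$ define constants ${}_m\tilde\gamma_n$ ($n\ge0$) by the Laurent expansion about $s=1$ $$\mathcal{H}^m(s)=\sum_{j=0}^m\binom{m}{j}\frac{\gamma^{m-j}j!}{(s-1)^{j+1}}+\sum_{n=0}^\infty\frac{(-1)^n}{n!}\,{}_m\tilde\gamma_n\,(s-1)^n .$$ Then for all integers $m\ge0$ and $n\ge0$, $${}_m\tilde\gamma_n=\lim_{N\to\infty}\left[\sum_{k=1}^N\frac{H_k^m\log^n(k)}{k}-\sum_{j=0}^m\binom{m}{j}\gamma^{m-j}\frac{\log^{n+j+1}(N)}{n+j+1}\right].$$
   Context: $H_k=1+\frac12+\cdots+\frac1k$; $\mathcal{H}^m(s)=\sum_{n\ge1}H_n^m n^{-s}$ for $\Re(s)>1$, meromorphically continued to $\mathbb{C}$ (for $m=0$ this is the Riemann zeta function). $\gamma$ is the Euler–Mascheroni constant. *)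

theory Defs
  imports "HOL-Complex_Analysis.Complex_Analysis"
begin

definition harm_dirichlet :: "nat \<Rightarrow> complex \<Rightarrow> complex" where
  "harm_dirichlet m s = (\<Sum>k. harm (Suc k) ^ m * of_nat (Suc k) powr (- s))"

(* The library notion nicely_meromorphic_on fixes the value 0 at poles and rules out
   removable singularities, so the continuation is unique as a total function. *)
definition harm_zeta :: "nat \<Rightarrow> complex \<Rightarrow> complex" where
  "harm_zeta m = (THE F. F nicely_meromorphic_on UNIV \<and>
     (\<forall>s. Re s > 1 \<longrightarrow> F s = harm_dirichlet m s))"

(* The coefficient of (s - 1)^n in the Laurent expansion at 1 is (-1)^n / n! times this
   constant. The definition does not presuppose the shape of the principal part. *)
definition harm_stieltjes :: "nat \<Rightarrow> nat \<Rightarrow> complex" where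
  "harm_stieltjes m n =
     (-1) ^ n * fact n * fls_nth (laurent_expansion (harm_zeta m) 1) (int n)"

end

theory Submission
  imports Defs "HOL-Real_Asymp.Real_Asymp"
begin

text \<open>
  Write $D_m(s)$ for the Dirichlet series of $H_n^m$.
  The telescoping sum of $H_n^m n^{1-s} - H_{n-1}^m (n-1)^{1-s}$ vanishes for $\Re(s) > 1$;
  since $H_{n-1} = H_n - 1/n$, expanding $(1 - 1/n)^{1-s}$ to finite order expresses
  $(1-s) D_m(s)$ by values of $D_j$ with $j < m$, values of $D_m$ at points shifted to the right,
  and an error series converging in a larger half-plane. Iterating, $D_m$ continues
  meromorphically to the whole plane.

  Near $s = 1$, $H_n = \log n + \gamma + O(1/n)$ makes the series of
  $(H_n^m - (\log n + \gamma)^m) n^{-s}$ holomorphic for $\Re(s) > 0$, and the binomial theorem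
  reduces $(\log n + \gamma)^m$ to derivatives of $\zeta(s)$. Since $\zeta(s) - 1/(s-1)$ is the
  sum of $n^{-s} - \int_n^{n+1} x^{-s} dx$ for $\Re(s) > 0$, the principal part can be read off,
  and differentiating the two locally uniformly convergent series termwise at $s = 1$ yields
  the limit.
\<close>

section \<open>Meromorphic continuation and series on half-planes\<close>

text \<open>Identity theorem applied to the difference: with removable singularities filled it is
  nicely meromorphic and vanishes around a point of \<open>U\<close>, hence on all of
  \<open>A\<close>. Filling may change values at isolated points, so the conclusion concerns
  punctured neighbourhoods only.\<close>

lemma eventually_eq_meromorphic:
  assumes f: "f meromorphic_on A" and g: "g meromorphic_on A"
    and A: "open A" "connected A"
    and U: "open U" "U \<noteq> {}" "U \<subseteq> A" "\<And>z. z \<in> U \<Longrightarrow> f z = g z"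
    and z: "z \<in> A"
  shows "eventually (\<lambda>w. f w = g w) (at z)"
proof -
  define h where "h = remove_sings (\<lambda>z. f z - g z)"
  have d: "(\<lambda>z. f z - g z) meromorphic_on A"
    by (intro meromorphic_intros f g)
  have ev: "eventually (\<lambda>w. h w = f w - g w) (at w)" if "w \<in> A" for w
    unfolding h_def
    by (rule eventually_remove_sings_eq_at, rule meromorphic_on_isolated_singularity)
       (use d that in \<open>auto intro: meromorphic_on_subset\<close>)
  have h: "h nicely_meromorphic_on A"
    unfolding h_def by (rule remove_sings_nicely_meromorphic[OF d])
  obtain u where u: "u \<in> U" using U by auto
  have "eventually (\<lambda>w. w \<in> U) (at u)"
    by (rule eventually_at_in_open') (use U u in auto)
  moreover have "eventually (\<lambda>w. h w = f w - g w) (at u)"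
    using ev u U by auto
  ultimately have "eventually (\<lambda>w. h w = 0) (at u)"
    by eventually_elim (use U in auto)
  hence "frequently (\<lambda>w. h w = 0) (at u)"
    by (intro eventually_frequently) auto
  hence 0: "h w = 0" if "w \<in> A" for w
    using frequently_eq_meromorphic_imp_constant[of h 0 u A w] h A u U that by auto
  have "eventually (\<lambda>w. w \<in> A) (at z)"
    by (rule eventually_at_in_open') (use A z in auto)
  with ev[OF z] show ?thesis
    by eventually_elim (use 0 in auto)
qed

lemma nicely_meromorphic_on_cong_at:
  assumes "f nicely_meromorphic_on A" "z \<in> A" 
  assumes "eventually (\<lambda>w. f w = g w) (nhds z)"
  shows "g nicely_meromorphic_on {z}"
proof -
  have at: "eventually (\<lambda>w. f w = g w) (at z)" and z: "f z = g z"
    using assms(3) by (simp_all add: eventually_nhds_conv_at)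
  have "f meromorphic_on {z}"
    using assms unfolding nicely_meromorphic_on_def by (auto intro: meromorphic_on_subset)
  hence "g meromorphic_on {z}"
    using meromorphic_on_cong[of "{z}" f g "{z}"] at by auto
  moreover have "is_pole f z \<longleftrightarrow> is_pole g z"
    by (rule is_pole_cong[OF at refl])
  moreover have "f \<midarrow>z\<rightarrow> f z \<longleftrightarrow> g \<midarrow>z\<rightarrow> g z"
    using tendsto_cong[OF at] z by simp
  ultimately show ?thesis
    using assms z unfolding nicely_meromorphic_on_def by auto
qed

text \<open>The convention for nicely meromorphic functions upgrades agreement near \<open>z\<close>
  to agreement at \<open>z\<close>: at a common pole both values are 0, and elsewhere both are the
  same limit.\<close>

lemma nicely_meromorphic_eqI:
  assumes f: "f nicely_meromorphic_on A" and g: "g nicely_meromorphic_on A"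
    and A: "open A" "connected A"
    and U: "open U" "U \<noteq> {}" "U \<subseteq> A" "\<And>z. z \<in> U \<Longrightarrow> f z = g z"
    and z: "z \<in> A"
  shows "f z = g z"
proof -
  have ev: "eventually (\<lambda>w. f w = g w) (at z)"
    by (rule eventually_eq_meromorphic[of f A g U])
       (use assms in \<open>auto simp: nicely_meromorphic_on_def\<close>)
  have pole: "is_pole f z \<longleftrightarrow> is_pole g z"
    by (rule is_pole_cong[OF ev refl])
  show ?thesis
  proof (cases "is_pole f z")
    case True
    hence "\<not> (f \<midarrow>z\<rightarrow> f z)" "\<not> (g \<midarrow>z\<rightarrow> g z)"
      using pole not_tendsto_and_filterlim_at_infinity[OF at_neq_bot] unfolding is_pole_def by blast+
    hence "f z = 0" "g z = 0" using f g z unfolding nicely_meromorphic_on_def by blast+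
    thus ?thesis by simp
  next
    case False
    hence "f \<midarrow>z\<rightarrow> f z" "g \<midarrow>z\<rightarrow> g z"
      using f g z pole unfolding nicely_meromorphic_on_def by auto
    moreover have "g \<midarrow>z\<rightarrow> f z"
      using tendsto_cong[OF ev] \<open>f \<midarrow>z\<rightarrow> f z\<close> by simp
    ultimately show ?thesis using LIM_unique by blast
  qed
qed

text \<open>Supplies the existence and the uniqueness behind the \<open>THE\<close> in
  \<open>harm_zeta\<close>. Continuations to growing half-planes agree on overlaps by the identity
  theorem, so they glue to one function.\<close>

lemma nicely_meromorphic_extension_UNIV:
  fixes D :: "complex \<Rightarrow> complex" and c :: real
  assumes hol: "D holomorphic_on {s. c < Re s}"
    and cont: "\<And>K::nat. \<exists>F. F meromorphic_on {s. c - real K < Re s} \<and> (\<forall>s. c < Re s \<longrightarrow> F s = D s)"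
  shows "\<exists>!F. F nicely_meromorphic_on UNIV \<and> (\<forall>s. c < Re s \<longrightarrow> F s = D s)"
proof (rule ex_ex1I)
  let ?H = "\<lambda>K::nat. {s. c - real K < Re s}"
  have conn: "connected {s. x < Re s}" for x
    by (intro convex_connected convex_halfspace_Re_gt)
  have ne: "{s. x < Re s} \<noteq> {}" for x
    using gt_ex[of x] by (auto intro: exI[of _ "of_real _"])
  have "\<exists>F. F nicely_meromorphic_on ?H K \<and> (\<forall>s. c < Re s \<longrightarrow> F s = D s)" for K
  proof -
    obtain F where F: "F meromorphic_on ?H K" "\<And>s. c < Re s \<Longrightarrow> F s = D s"
      using cont by blast
    \<comment> \<open>Since \<open>D\<close> is holomorphic, removing singularities does not change
      \<open>F\<close> on the initial half-plane.\<close>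
    have "F holomorphic_on {s. c < Re s}"
      using hol holomorphic_cong[OF refl, of "{s. c < Re s}" F D] F by auto
    hence "F analytic_on {s}" if "c < Re s" for s
      using that analytic_at open_halfspace_Re_gt by blast
    hence "remove_sings F s = D s" if "c < Re s" for s
      using that F by simp
    thus ?thesis
      using remove_sings_nicely_meromorphic[OF F(1)] by blast
  qed
  then obtain F where F: "\<And>K. F K nicely_meromorphic_on ?H K"
      "\<And>K s. c < Re s \<Longrightarrow> F K s = D s"
    by metis
  have agree': "F K s = F L s" if "K \<le> L" "s \<in> ?H K" for K L s
  proof (rule nicely_meromorphic_eqI[of "F K" "?H K" "F L" "{s. c < Re s}" s])
    show "F L nicely_meromorphic_on ?H K"
      by (rule nicely_meromorphic_on_subset[OF F(1)]) (use that in auto)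
    show "F K z = F L z" if "z \<in> {s. c < Re s}" for z
      using that F(2) by simp
    show "{s. c < Re s} \<subseteq> ?H K" by auto
  qed (rule F conn ne open_halfspace_Re_gt that)+
  have agree: "F K s = F L s" if "s \<in> ?H K" "s \<in> ?H L" for K L s
    using agree'[OF _ that(1), of L] agree'[OF _ that(2), of K] by (metis nat_le_linear)
  \<comment> \<open>Any natural number above \<open>c - Re s\<close> serves; \<open>nat\<close>
    covers the points where this difference is very negative.\<close>
  define k where "k s = nat (\<lceil>c - Re s\<rceil> + 1)" for s
  have k: "s \<in> ?H (k s)" for s
    unfolding k_def by simp linarith
  define G where "G s = F (k s) s" for s
  have G: "G s = F K s" if "s \<in> ?H K" for s K
    unfolding G_def using agree that k by blast
  have "G nicely_meromorphic_on {z}" for z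
  proof (rule nicely_meromorphic_on_cong_at[OF F(1)])
    show "z \<in> ?H (k z)" by (rule k)
    have "eventually (\<lambda>w. w \<in> ?H (k z)) (nhds z)"
      by (rule eventually_nhds_in_open[OF open_halfspace_Re_gt k])
    thus "eventually (\<lambda>w. F (k z) w = G w) (nhds z)"
      by eventually_elim (use G in auto)
  qed
  hence "G nicely_meromorphic_on UNIV"
    unfolding nicely_meromorphic_on_def using meromorphic_on_meromorphic_at by blast
  moreover have "G s = D s" if "c < Re s" for s
    using G[of s 0] F(2) that by simp
  ultimately show "\<exists>F. F nicely_meromorphic_on UNIV \<and> (\<forall>s. c < Re s \<longrightarrow> F s = D s)"
    by blast
next
  fix F G
  assume *: "F nicely_meromorphic_on UNIV \<and> (\<forall>s. c < Re s \<longrightarrow> F s = D s)"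
    "G nicely_meromorphic_on UNIV \<and> (\<forall>s. c < Re s \<longrightarrow> G s = D s)"
  have ne: "{s. c < Re s} \<noteq> {}"
    using gt_ex[of c] by (auto intro: exI[of _ "of_real _"])
  show "F = G"
    by (rule ext, rule nicely_meromorphic_eqI[of F UNIV G "{s. c < Re s}"])
       (use * ne in \<open>auto simp: open_halfspace_Re_gt\<close>)
qed

text \<open>Weierstrass M-test on a neighbourhood of each point. The majorant may depend on the
  margin \<open>e\<close> and on a bound \<open>B\<close> for \<open>norm s\<close>, because the
  estimates for \<open>zeta_reg_term\<close> and \<open>shift_error\<close> grow with
  \<open>s\<close>; requiring it only eventually exempts the first term of
  \<open>shift_error\<close>.\<close>

lemma holomorphic_series:
  fixes f :: "nat \<Rightarrow> complex \<Rightarrow> complex" and c :: real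
  assumes hol: "\<And>n. f n holomorphic_on {s. c < Re s}"
    and bound: "\<And>e B. e > 0 \<Longrightarrow> \<exists>h. summable h \<and> 
      (\<forall>\<^sub>F n in sequentially. \<forall>s. c + e < Re s \<longrightarrow> norm s < B \<longrightarrow> norm (f n s) \<le> h n)"
  shows "\<And>s. c < Re s \<Longrightarrow> (\<lambda>n. f n s) sums (\<Sum>n. f n s)"
    and "(\<lambda>s. \<Sum>n. f n s) holomorphic_on {s. c < Re s}"
    and "\<And>s. c < Re s \<Longrightarrow> (\<lambda>n. (deriv ^^ k) (f n) s) sums (deriv ^^ k) (\<lambda>s. \<Sum>n. f n s) s"
proof -
  have locunif: "\<exists>V. open V \<and> s \<in> V \<and> V \<subseteq> {s. c < Re s} \<and> 
      uniform_limit V (\<lambda>n s. \<Sum>i<n. f i s) (\<lambda>s. \<Sum>n. f n s) sequentially" if s: "c < Re s" for s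
  proof -
    define e where "e = (Re s - c) / 2"
    define V where "V = {w. c + e < Re w} \<inter> ball 0 (norm s + 1)"
    have e: "e > 0" "c + e < Re s" using s by (auto simp: e_def field_simps)
    obtain h where h: "summable h"
       "\<forall>\<^sub>F n in sequentially. \<forall>w. c + e < Re w \<longrightarrow> norm w < norm s + 1 \<longrightarrow> norm (f n w) \<le> h n"
      using bound[of e "norm s + 1"] e by blast
    have "\<forall>\<^sub>F n in sequentially. \<forall>w\<in>V. norm (f n w) \<le> h n"
      using h(2) by eventually_elim (auto simp: V_def)
    hence "uniform_limit V (\<lambda>n s. \<Sum>i<n. f i s) (\<lambda>s. \<Sum>n. f n s) sequentially"
      by (rule Weierstrass_m_test_ev[OF _ h(1)])
    moreover have "open V" "s \<in> V" "V \<subseteq> {s. c < Re s}"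
      unfolding V_def using e by (auto simp: open_halfspace_Re_gt intro!: open_Int)
    ultimately show ?thesis by blast
  qed
  have holV: "(\<lambda>s. \<Sum>i<n. f i s) holomorphic_on V" if "V \<subseteq> {s. c < Re s}" for V n
    by (intro holomorphic_on_sum holomorphic_on_subset[OF hol that])
  have 1: "(\<lambda>n. f n s) sums (\<Sum>n. f n s)" if s: "c < Re s" for s
    using locunif[OF s] unfolding sums_def by (auto dest: tendsto_uniform_limitI)
  have 2: "(\<lambda>n. (deriv ^^ k) (f n) s) sums (deriv ^^ k) (\<lambda>s. \<Sum>n. f n s) s" if s: "c < Re s" for s
  proof -
    obtain V where V: "open V" "s \<in> V" "V \<subseteq> {s. c < Re s}"
      "uniform_limit V (\<lambda>n s. \<Sum>i<n. f i s) (\<lambda>s. \<Sum>n. f n s) sequentially"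
      using locunif[OF s] by blast
    have "(\<lambda>n. (deriv ^^ k) (\<lambda>s. \<Sum>i<n. f i s) s) \<longlonglongrightarrow> (deriv ^^ k) (\<lambda>s. \<Sum>n. f n s) s"
      by (rule higher_deriv_complex_uniform_limit[OF V(4) _ _ V(1,2)]) (use holV V in auto)
    moreover have "(deriv ^^ k) (\<lambda>s. \<Sum>i<n. f i s) s = (\<Sum>i<n. (deriv ^^ k) (f i) s)" for n
    proof (induction n)
      case (Suc n)
      have "(deriv ^^ k) (\<lambda>s. (\<Sum>i<n. f i s) + f n s) s = 
          (deriv ^^ k) (\<lambda>s. \<Sum>i<n. f i s) s + (deriv ^^ k) (f n) s"
        by (rule higher_deriv_add[of _ V]) (use holV V holomorphic_on_subset[OF hol V(3)] in auto)
      thus ?case using Suc by simp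
    qed auto
    ultimately show ?thesis unfolding sums_def by simp
  qed
  show "\<And>s. c < Re s \<Longrightarrow> (\<lambda>n. f n s) sums (\<Sum>n. f n s)"
    and "\<And>s. c < Re s \<Longrightarrow> (\<lambda>n. (deriv ^^ k) (f n) s) sums (deriv ^^ k) (\<lambda>s. \<Sum>n. f n s) s"
    by (fact 1 2)+
  show "(\<lambda>s. \<Sum>n. f n s) holomorphic_on {s. c < Re s}"
  proof (rule holomorphic_uniform_sequence[OF open_halfspace_Re_gt holV[OF order.refl]])
    fix s assume "s \<in> {s. c < Re s}"
    then obtain V where V: "open V" "s \<in> V" "V \<subseteq> {s. c < Re s}"
      "uniform_limit V (\<lambda>n s. \<Sum>i<n. f i s) (\<lambda>s. \<Sum>n. f n s) sequentially"
      using locunif by blast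
    obtain d where "d > 0" "cball s d \<subseteq> V" using V open_contains_cball by blast
    thus "\<exists>d>0. cball s d \<subseteq> {s. c < Re s} \<and> 
      uniform_limit (cball s d) (\<lambda>n s. \<Sum>i<n. f i s) (\<lambda>s. \<Sum>n. f n s) sequentially"
      using V uniform_limit_on_subset by blast
  qed
qed

section \<open>Estimates\<close>

lemma harm_le_ln: "harm (Suc k) \<le> 1 + ln (real (Suc k))"
proof -
  have "harm (Suc k) - ln (real (Suc k)) \<le> harm (Suc 0) - ln (real (Suc 0))"
    using decseqD[OF decseq_harm_diff_ln, of 0 k] by simp
  thus ?thesis by (simp add: harm_expand)
qed

text \<open>The library bounds compare with \<open>ln (n + 1)\<close>, where n = k + 1. Their error
  and the cost of passing to \<open>ln n\<close> each affect only one side of the inequality, so the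
  total stays within 1/n.\<close>

lemma harm_approx: "\<bar>harm (Suc k) - (ln (real (Suc k)) + euler_mascheroni)\<bar> \<le> 1 / real (Suc k)"
proof -
  let ?n = "real (Suc k)"
  have "euler_mascheroni \<in> {harm (Suc k) - ln (real (Suc (Suc k))) + inverse (real (2*(Suc k+1)))
     ..harm (Suc k) - ln (real (Suc (Suc k))) + inverse (real (2 * Suc k))}"
    using euler_mascheroni_bounds[of "Suc k"] by simp
  hence 1: "euler_mascheroni \<ge> harm (Suc k) - ln (real (Suc (Suc k)))"
     "euler_mascheroni \<le> harm (Suc k) - ln (real (Suc (Suc k))) + 1 / real (2 * Suc k)"
    by (auto simp: field_simps intro: order.trans[rotated])
  have 2: "ln (real (Suc (Suc k))) - ln ?n \<le> 1 / ?n"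
    using ln_diff_le_inverse[of ?n] by (simp add: field_simps)
  have 3: "ln (real (Suc (Suc k))) \<ge> ln ?n" by simp
  have "1 / real (2 * Suc k) \<le> 1 / ?n" by (intro divide_left_mono) auto
  moreover have "\<bar>h - (l + g)\<bar> \<le> u" if "g \<ge> h - l'" "g \<le> h - l' + v" "l' - l \<le> u" "l' \<ge> l" "v \<le> u"
    for h l g u l' v :: real
    using that by linarith
  ultimately show ?thesis using 1 2 3 by blast
qed

text \<open>Dividing by \<open>M\<close> brings both bases into the unit interval, where
  \<open>norm_power_diff\<close> applies.\<close>

lemma abs_power_diff_le:
  fixes a b :: real
  assumes "\<bar>a\<bar> \<le> M" "\<bar>b\<bar> \<le> M" "1 \<le> M"
  shows "\<bar>a ^ m - b ^ m\<bar> \<le> m * M ^ m * \<bar>a - b\<bar>"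
proof -
  have "\<bar>(a / M) ^ m - (b / M) ^ m\<bar> \<le> m * \<bar>a / M - b / M\<bar>"
    using norm_power_diff[of "a / M" "b / M" m] assms by simp
  also have "(a / M) ^ m - (b / M) ^ m = (a ^ m - b ^ m) / M ^ m"
    by (simp add: power_divide diff_divide_distrib)
  also have "m * \<bar>a / M - b / M\<bar> \<le> m * \<bar>a - b\<bar>"
    using assms mult_right_mono[of 1 M "\<bar>a - b\<bar>"]
    by (intro mult_left_mono) (auto simp: diff_divide_distrib[symmetric] field_simps)
  finally show ?thesis
    using assms by (simp add: abs_divide field_simps)
qed

text \<open>The logarithms are absorbed by a power of n with exponent \<open>e / 2\<close>, which
  leaves the summable exponent \<open>- 1 - e / 2\<close>.\<close>

lemma summable_ln_power_powr:
  assumes e: "0 < (e :: real)"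
  shows "summable (\<lambda>k. (1 + ln (real (Suc k))) ^ p * real (Suc k) powr - (1 + e))"
proof -
  \<comment> \<open>All \<open>p\<close> logarithmic factors together cost at most
    \<open>e / 2\<close>; the \<open>+ 1\<close> keeps the divisor positive when
    \<open>p = 0\<close>.\<close>
  define a where "a = e / (2 * (real p + 1))"
  have a: "a > 0" and ap: "a * p \<le> e / 2"
    using e by (simp_all add: a_def field_simps)
  show ?thesis
  proof (rule summable_comparison_test[OF exI[of _ 0]], safe)
    fix k :: nat
    let ?n = "real (Suc k)"
    have "1 + ln ?n \<le> ?n powr a + ?n powr a / a"
      using a ln_powr_bound[of ?n a] ge_one_powr_ge_zero[of ?n a] by auto
    hence "(1 + ln ?n) ^ p \<le> ((1 + 1 / a) * ?n powr a) ^ p"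
      by (intro power_mono) (auto simp: algebra_simps)
    also have "\<dots> = (1 + 1 / a) ^ p * ?n powr (a * p)"
      by (simp add: power_mult_distrib powr_power mult.commute)
    also have "\<dots> \<le> (1 + 1 / a) ^ p * ?n powr (e / 2)"
      using a ap by (intro mult_left_mono powr_mono) auto
    finally have "(1 + ln ?n) ^ p * ?n powr - (1 + e) \<le> (1 + 1 / a) ^ p * ?n powr (e / 2) * ?n powr - (1 + e)"
      by (rule mult_right_mono) auto
    also have "\<dots> = (1 + 1 / a) ^ p * ?n powr (- 1 - e / 2)"
      unfolding mult.assoc powr_add[symmetric] by (rule arg_cong[of _ _ "\<lambda>t. _ * _ powr t"]) simp
    finally show "norm ((1 + ln ?n) ^ p * ?n powr - (1 + e)) \<le> (1 + 1 / a) ^ p * ?n powr (- 1 - e / 2)"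
      by simp
  next
    have "summable (\<lambda>k. real (Suc k) powr (- 1 - e / 2))"
      by (subst summable_Suc_iff) (use e in \<open>simp add: summable_real_powr_iff\<close>)
    thus "summable (\<lambda>k. (1 + 1 / a) ^ p * real (Suc k) powr (- 1 - e / 2))"
      by (rule summable_mult)
  qed
qed

lemma norm_of_nat_powr: "norm (of_nat n powr s :: complex) = real n powr Re s"
  using norm_powr_real_powr[of "of_nat n" s] by simp

lemma powr_uminus_Re_le:
  assumes "c < Re s" 
  shows "real (Suc k) powr (- Re s) \<le> real (Suc k) powr - c"
  using assms by (intro powr_mono) auto

text \<open>Each factor of the Pochhammer product satisfies |i - w| \<le> B + i. The bounds are the
  Taylor coefficients of (1 - x)^(-B), which will serve as a majorant.\<close>

lemma norm_gbinomial_le: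
  fixes w :: complex
  assumes "norm w \<le> B"
  shows "norm (w gchoose k) \<le> pochhammer B k / fact k"
proof -
  have "norm (pochhammer (- w) k) \<le> pochhammer B k"
    unfolding pochhammer_prod
    by (rule order.trans[OF norm_prod_le prod_mono])
       (use assms in \<open>auto intro: order.trans[OF norm_triangle_ineq4]\<close>)
  thus ?thesis
    by (simp add: gbinomial_pochhammer norm_mult norm_divide norm_power divide_right_mono)
qed

text \<open>The constant is uniform in \<open>w\<close> on the disc of radius \<open>B\<close>:
  after pulling out x^P, the tail of the binomial series is dominated by that of (1 - x)^(-B) at x =
  1/2, up to a factor 2^P.\<close>

lemma binomial_remainder_bound:
  obtains C where "\<And>w x. norm w \<le> B \<Longrightarrow> 0 \<le> x \<Longrightarrow> x \<le> 1 / 2 \<Longrightarrow>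
    norm ((1 - complex_of_real x) powr w - (\<Sum>k<P. (w gchoose k) * (- of_real x) ^ k)) \<le> C * x ^ P"
proof -
  define c where "c k = pochhammer B k / fact k" for k
  have "(\<lambda>k. (- B gchoose k) * (- (1/2)) ^ k) sums (1 + - (1/2)) powr - B"
    by (rule gen_binomial_real) auto
  also have "(\<lambda>k. (- B gchoose k) * (- (1/2)) ^ k) = (\<lambda>k. c k * (1/2) ^ k)"
    by (simp add: gbinomial_pochhammer c_def fun_eq_iff power_mult_distrib[symmetric] mult_ac)
  finally have sc: "summable (\<lambda>k. c k * (1/2) ^ k)" by (rule sums_summable)
  define C where "C = (\<Sum>k. c (k + P) * (1/2) ^ k)"
  have sc': "summable (\<lambda>k. c (k + P) * (1/2) ^ k)"
  proof -
    have "summable (\<lambda>k. c (k + P) * (1/2) ^ (k + P) * 2 ^ P)"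
      using sc by (intro summable_mult2) (subst summable_iff_shift)
    thus ?thesis by (simp add: power_add power_divide)
  qed
  show ?thesis
  proof (rule that[of C])
    fix w :: complex and x :: real
    assume w: "norm w \<le> B" and x: "0 \<le> x" "x \<le> 1 / 2"
    define z where "z = - complex_of_real x"
    have z: "norm z = x" using x by (simp add: z_def)
    have s: "(\<lambda>k. (w gchoose k) * z ^ k) sums (1 + z) powr w"
      by (rule gen_binomial_complex) (use z x in auto)
    hence s': "(\<lambda>k. (w gchoose (k + P)) * z ^ (k + P)) sums ((1 + z) powr w - (\<Sum>k<P. (w gchoose k) * z ^ k))"
      by (rule sums_split_initial_segment)
    have bnd: "norm ((w gchoose (k + P)) * z ^ (k + P)) \<le> c (k + P) * (1/2) ^ k * x ^ P" for k
    proof -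
      have "norm ((w gchoose (k + P)) * z ^ (k + P)) = norm (w gchoose (k + P)) * (x ^ k * x ^ P)"
        by (simp add: norm_mult norm_power z power_add)
      also have "\<dots> \<le> c (k + P) * ((1/2) ^ k * x ^ P)"
        using norm_gbinomial_le[OF w, of "k + P"] x order.trans[OF norm_ge_zero norm_gbinomial_le[OF w, of "k + P"]]
        unfolding c_def by (intro mult_mono power_mono) auto
      finally show ?thesis by (simp add: mult_ac)
    qed
    have "norm ((1 + z) powr w - (\<Sum>k<P. (w gchoose k) * z ^ k)) 
      = norm (\<Sum>k. (w gchoose (k + P)) * z ^ (k + P))"
      using s' by (simp add: sums_iff)
    also have "\<dots> \<le> (\<Sum>k. c (k + P) * (1/2) ^ k * x ^ P)"
      by (rule norm_suminf_le) (use bnd sc' in \<open>auto intro: summable_mult2\<close>)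
    also have "\<dots> = C * x ^ P"
      unfolding C_def by (rule suminf_mult2[OF sc', symmetric])
    finally show "norm ((1 - complex_of_real x) powr w - (\<Sum>k<P. (w gchoose k) * (- of_real x) ^ k)) \<le> C * x ^ P"
      by (simp add: z_def)
  qed
qed

section \<open>Dirichlet series and their derivatives\<close>

lemma higher_deriv_eigenfunction:
  fixes f :: "complex \<Rightarrow> complex"
  assumes "\<And>s. (f has_field_derivative c * f s) (at s)"
  shows "(deriv ^^ k) f s = c ^ k * f s"
proof (induction k arbitrary: s)
  case (Suc k)
  have "(deriv ^^ k) f = (\<lambda>s. c ^ k * f s)" using Suc by auto
  moreover have "deriv (\<lambda>s. c ^ k * f s) s = c ^ Suc k * f s"
    by (rule DERIV_imp_deriv) (auto intro!: derivative_eq_intros assms)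
  ultimately show ?case by simp
qed auto

lemma exp_ln_powr:
  "exp (- of_real (ln (real (Suc n))) * s) = of_nat (Suc n) powr (- s :: complex)"
  using Ln_of_real[of "real (Suc n)"] by (simp add: powr_def mult.commute del: of_nat_Suc)

lemma higher_deriv_of_nat_powr:
  fixes s :: complex
  shows "(deriv ^^ k) (\<lambda>s. of_nat (Suc n) powr (- s)) s = (- of_real (ln (real (Suc n)))) ^ k * of_nat (Suc n) powr (- s)"
proof (rule higher_deriv_eigenfunction[of "\<lambda>s. of_nat (Suc n) powr (- s)"])
  show "((\<lambda>s. of_nat (Suc n) powr (- s)) has_field_derivative 
     - of_real (ln (real (Suc n))) * of_nat (Suc n) powr (- s)) (at s)" for s :: complex
    unfolding exp_ln_powr[symmetric] by (auto intro!: derivative_eq_intros)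
qed

text \<open>The decay n^(-d) of the coefficients moves the half-plane of convergence to Re s > 1 -
  d, and powers of logarithms cost only an arbitrarily small margin. It is used with d = 0 for the
  original series and with d = 1 for the differences from (log n + gamma)^m.\<close>

lemma dirichlet_series:
  fixes a :: "nat \<Rightarrow> complex"
  assumes a: "\<And>k. norm (a k) \<le> C * (1 + ln (real (Suc k))) ^ p * real (Suc k) powr - d"
  defines "F \<equiv> \<lambda>s. \<Sum>k. a k * of_nat (Suc k) powr (- s)"
  shows "\<And>s. 1 - d < Re s \<Longrightarrow> (\<lambda>k. a k * of_nat (Suc k) powr (- s)) sums F s"
    and "F holomorphic_on {s. 1 - d < Re s}"
    and "\<And>s. 1 - d < Re s \<Longrightarrow>
      (\<lambda>k. a k * (- of_real (ln (real (Suc k)))) ^ j * of_nat (Suc k) powr (- s)) sums (deriv ^^ j) F s"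
proof -
  let ?f = "\<lambda>k s. a k * of_nat (Suc k) powr (- s)"
  have hol: "?f k holomorphic_on A" for k A
    by (intro holomorphic_intros)
  have bound: "\<exists>h. summable h \<and> (\<forall>\<^sub>F k in sequentially. 
        \<forall>s. 1 - d + e < Re s \<longrightarrow> norm s < B \<longrightarrow> norm (?f k s) \<le> h k)" if e: "e > 0" for e B
  proof (intro exI[of _ "\<lambda>k. C * ((1 + ln (real (Suc k))) ^ p * real (Suc k) powr - (1 + e))"]
      conjI always_eventually allI impI)
    show "summable (\<lambda>k. C * ((1 + ln (real (Suc k))) ^ p * real (Suc k) powr - (1 + e)))"
      by (intro summable_mult summable_ln_power_powr e)
    fix k and s :: complex assume s: "1 - d + e < Re s"
    have "norm (?f k s) = norm (a k) * real (Suc k) powr (- Re s)"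
      by (simp only: norm_mult norm_of_nat_powr) simp
    also have "\<dots> \<le> (C * (1 + ln (real (Suc k))) ^ p * real (Suc k) powr - d) * real (Suc k) powr (- (1 - d + e))"
      by (intro mult_mono a powr_uminus_Re_le s order.trans[OF norm_ge_zero a]) auto
    also have "\<dots> = C * ((1 + ln (real (Suc k))) ^ p * real (Suc k) powr - (1 + e))"
      by (simp add: mult.assoc powr_add[symmetric] add.commute)
    finally show "norm (?f k s) \<le> C * ((1 + ln (real (Suc k))) ^ p * real (Suc k) powr - (1 + e))" .
  qed
  show "(\<lambda>k. ?f k s) sums F s" if "1 - d < Re s" for s
    unfolding F_def by (rule holomorphic_series(1)[OF hol bound that])
  show "F holomorphic_on {s. 1 - d < Re s}"
    unfolding F_def by (rule holomorphic_series(2)[OF hol bound])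
  show "(\<lambda>k. a k * (- of_real (ln (real (Suc k)))) ^ j * of_nat (Suc k) powr (- s)) sums (deriv ^^ j) F s"
    if "1 - d < Re s" for s
  proof -
    have "(\<lambda>k. (deriv ^^ j) (?f k) s) sums (deriv ^^ j) F s"
      unfolding F_def by (rule holomorphic_series(3)[OF hol bound that])
    moreover have "(deriv ^^ j) (?f k) s = a k * (- of_real (ln (real (Suc k)))) ^ j * of_nat (Suc k) powr (- s)" for k
      by (subst higher_deriv_cmult[of _ UNIV])
         (auto simp: higher_deriv_of_nat_powr simp del: of_nat_Suc intro!: holomorphic_intros)
    ultimately show ?thesis by simp
  qed
qed

text \<open>Leibniz rule with a linear factor, so only two terms survive. For \<open>k = 0\<close>
  the truncated index \<open>k - 1\<close> is multiplied by 0.\<close>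

lemma higher_deriv_mult_linear:
  fixes f :: "complex \<Rightarrow> complex"
  assumes f: "f holomorphic_on UNIV"
  shows "(deriv ^^ k) (\<lambda>s. (s - a) * f s) s = (s - a) * (deriv ^^ k) f s + of_nat k * (deriv ^^ (k - 1)) f s"
proof (induction k arbitrary: s)
  case (Suc k)
  have d: "((deriv ^^ i) f has_field_derivative (deriv ^^ Suc i) f s) (at s)" for i
    using holomorphic_derivI[OF holomorphic_higher_deriv[OF f open_UNIV, of i] open_UNIV UNIV_I] by simp
  have "(deriv ^^ k) (\<lambda>s. (s - a) * f s) = (\<lambda>s. (s - a) * (deriv ^^ k) f s + of_nat k * (deriv ^^ (k - 1)) f s)"
    using Suc by auto
  moreover have "deriv (\<lambda>s. (s - a) * (deriv ^^ k) f s + of_nat k * (deriv ^^ (k - 1)) f s) s = 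
     (s - a) * (deriv ^^ Suc k) f s + of_nat (Suc k) * (deriv ^^ k) f s"
  proof (rule DERIV_imp_deriv, cases k)
    case 0
    show "((\<lambda>s. (s - a) * (deriv ^^ k) f s + of_nat k * (deriv ^^ (k - 1)) f s) has_field_derivative 
       (s - a) * (deriv ^^ Suc k) f s + of_nat (Suc k) * (deriv ^^ k) f s) (at s)"
      using 0 d[of 0] by (auto intro!: derivative_eq_intros)
  next
    case (Suc j)
    have "((\<lambda>s. (s - a) * (deriv ^^ k) f s + of_nat k * (deriv ^^ j) f s) has_field_derivative 
       (1 * (deriv ^^ k) f s + (deriv ^^ Suc k) f s * (s - a)) + of_nat k * (deriv ^^ Suc j) f s) (at s)"
      by (intro DERIV_add DERIV_mult DERIV_cmult d) (auto intro!: derivative_eq_intros)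
    thus "((\<lambda>s. (s - a) * (deriv ^^ k) f s + of_nat k * (deriv ^^ (k - 1)) f s) has_field_derivative 
       (s - a) * (deriv ^^ Suc k) f s + of_nat (Suc k) * (deriv ^^ k) f s) (at s)"
      using Suc by (simp add: algebra_simps)
  qed
  ultimately show ?case by simp
qed auto

section \<open>The zeta function without its pole\<close>

text \<open>This is $\int_1^{e^L} x^{-s} dx$, extended analytically across $s = 1$.\<close>

definition powr_int :: "real \<Rightarrow> complex \<Rightarrow> complex" where
  "powr_int L s = (if s = 1 then of_real L else (1 - exp (- of_real L * (s - 1))) / (s - 1))"

lemma powr_int_mult: "(s - 1) * powr_int L s = 1 - exp (- of_real L * (s - 1))"
  by (simp add: powr_int_def)

lemma powr_int_0 [simp]: "powr_int 0 s = 0"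
  by (simp add: powr_int_def)

text \<open>The function is the difference quotient of -exp(-L (s - 1)) at 1, and its value at 1 is
  the derivative there, so the singularity is removed.\<close>

lemma holomorphic_powr_int [holomorphic_intros]: "powr_int L holomorphic_on A"
proof -
  let ?f = "\<lambda>s. - exp (- of_real L * (s - 1)) :: complex"
  have "deriv ?f 1 = of_real L"
    by (rule DERIV_imp_deriv) (auto intro!: derivative_eq_intros)
  hence "powr_int L = (\<lambda>s. if s = 1 then deriv ?f 1 else (?f s - ?f 1) / (s - 1))"
    by (auto simp: powr_int_def fun_eq_iff)
  moreover have "\<dots> holomorphic_on UNIV"
    by (rule pole_lemma_open) (auto intro!: holomorphic_intros)
  ultimately have "powr_int L holomorphic_on UNIV" by simp
  thus ?thesis by (rule holomorphic_on_subset) simp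
qed

text \<open>Differentiating the identity \<open>powr_int_mult\<close> k + 1 times at s = 1 kills the
  term with the factor s - 1. The result is (-1)^k times the integral of log^k(x)/x from 1 to
  e^L.\<close>

lemma higher_deriv_powr_int_1:
  "(deriv ^^ k) (powr_int L) 1 = (- 1) ^ k * of_real (L ^ Suc k / real (Suc k))"
proof -
  let ?f = "\<lambda>s. exp (- of_real L * (s - 1)) :: complex"
  have "(deriv ^^ Suc k) ?f 1 = (- of_real L) ^ Suc k * ?f 1"
    by (rule higher_deriv_eigenfunction) (auto intro!: derivative_eq_intros)
  moreover have "(deriv ^^ Suc k) (\<lambda>s. 1 - ?f s) 1 = (deriv ^^ Suc k) (\<lambda>s. 1) 1 - (deriv ^^ Suc k) ?f 1"
    by (rule higher_deriv_diff[of _ UNIV]) (auto intro!: holomorphic_intros)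
  moreover have "(deriv ^^ Suc k) (\<lambda>s. (s - 1) * powr_int L s) 1 = of_nat (Suc k) * (deriv ^^ k) (powr_int L) 1"
    by (subst higher_deriv_mult_linear) (auto intro: holomorphic_powr_int)
  ultimately have "of_nat (Suc k) * (deriv ^^ k) (powr_int L) 1 = - ((- of_real L) ^ Suc k)"
    unfolding powr_int_mult higher_deriv_const by simp
  also have "\<dots> = (- 1) ^ k * of_real (L ^ Suc k)"
    by (simp add: power_minus[of "of_real L"])
  finally have "(deriv ^^ k) (powr_int L) 1 = (- 1) ^ k * of_real (L ^ Suc k) / of_nat (Suc k)"
    by (metis nonzero_mult_div_cancel_left of_nat_eq_0_iff nat.distinct(2))
  thus ?thesis by (simp del: of_nat_Suc)
qed

text \<open>First-order Taylor expansion of an antiderivative of x^(-s) between k + 1 and k + 2. The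
  remainder is controlled by the derivative -s x^(-s-1), whose modulus is largest at the left
  end.\<close>

lemma powr_int_diff_bound:
  assumes "0 < Re s"
  shows "norm (of_nat (Suc k) powr (- s) - (powr_int (ln (real (Suc (Suc k)))) s - powr_int (ln (real (Suc k))) s))
    \<le> norm s * real (Suc k) powr - (1 + Re s)"
proof -
  let ?n = "complex_of_real (real (Suc k))" and ?n' = "complex_of_real (real (Suc (Suc k)))"
  \<comment> \<open>An antiderivative of x^(-s), then x^(-s) itself, then its derivative; the
    antiderivative is logarithmic exactly for s = 1.\<close>
  define F :: "nat \<Rightarrow> complex \<Rightarrow> complex" where
    "F i x = (if i = 0 then if s = 1 then Ln x else x powr (1 - s) / (1 - s)
       else if i = 1 then x powr (- s) else - s * x powr (- s - 1))" for i x
  define S where "S = complex_of_real ` {real (Suc k)..real (Suc (Suc k))}"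
  have S: "x \<notin> \<real>\<^sub>\<le>\<^sub>0" "x \<in> \<real>" "real (Suc k) \<le> Re x" if "x \<in> S" for x
    using that by (auto simp: S_def)
  have "norm (F 0 ?n' - (\<Sum>i\<le>1. F i ?n * (?n' - ?n) ^ i / fact i)) 
     \<le> norm s * real (Suc k) powr - (1 + Re s) * norm (?n' - ?n) ^ Suc 1 / fact 1"
  proof (rule field_Taylor[of S])
    show "convex S" unfolding S_def
      by (rule convex_linear_image) (auto simp: linear_iff scaleR_conv_of_real)
    show "?n \<in> S" "?n' \<in> S" unfolding S_def by (rule imageI, simp)+
    fix x assume x: "x \<in> S"
    show "(F i has_field_derivative F (Suc i) x) (at x within S)" if "i \<le> 1" for i
    proof -
      have p: "((\<lambda>x. x powr c) has_field_derivative c * x powr (c - 1)) (at x within S)" for c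
        by (rule has_field_derivative_at_within[OF has_field_derivative_powr]) (use S x in auto)
      have "x \<noteq> 0" using S(1)[OF x] by auto
      hence l: "(Ln has_field_derivative x powr (- 1)) (at x within S)"
        using has_field_derivative_at_within[OF has_field_derivative_Ln[OF S(1)[OF x]]]
        by (simp add: powr_minus)
      have F01: "F = (\<lambda>i. if i = 0 then (\<lambda>x. if s = 1 then Ln x else x powr (1 - s) / (1 - s))
         else if i = 1 then (\<lambda>x. x powr (- s)) else (\<lambda>x. - s * x powr (- s - 1)))"
        by (auto simp: F_def fun_eq_iff)
      have "i = 0 \<or> i = 1" using that by auto
      thus ?thesis
        using DERIV_cdivide[OF p[of "1 - s"], of "1 - s"] p[of "- s"] l
        unfolding F01 by (cases "s = 1") (auto simp: F_def)
    qed
    have "norm (F (Suc 1) x) = norm s * Re x powr (- Re s - 1)"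
      using S[OF x] by (simp add: F_def norm_mult norm_powr_real_powr)
    also have "\<dots> \<le> norm s * real (Suc k) powr (- Re s - 1)"
      using S[OF x] assms by (intro mult_left_mono powr_mono2') auto
    also have "- Re s - 1 = - (1 + Re s)" by simp
    finally show "norm (F (Suc 1) x) \<le> norm s * real (Suc k) powr - (1 + Re s)" .
  qed
  also have "?n' - ?n = 1" by simp
  also have "(\<Sum>i\<le>1. F i ?n * 1 ^ i / fact i) = F 0 ?n + of_nat (Suc k) powr (- s)"
    by (simp add: F_def)
  also have "F 0 ?n' - (F 0 ?n + of_nat (Suc k) powr (- s)) = 
     - (of_nat (Suc k) powr (- s) - (powr_int (ln (real (Suc (Suc k)))) s - powr_int (ln (real (Suc k))) s))"
  proof (cases "s = 1")
    case True
    thus ?thesis unfolding F_def powr_int_def 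
      using Ln_of_real[of "real (Suc k)"] Ln_of_real[of "real (Suc (Suc k))"] by (simp del: of_nat_Suc)
  next
    case False
    have "x / (1 - s) = - (x / (s - 1))" for x
      by (metis minus_diff_eq minus_divide_right)
    thus ?thesis using False unfolding F_def powr_int_def exp_ln_powr
      by (simp add: diff_divide_distrib del: of_nat_Suc)
  qed
  finally show ?thesis unfolding norm_minus_cancel by simp
qed

text \<open>With n = k + 1 this is n^(-s) minus the integral of x^(-s) over [n, n + 1].\<close>

definition zeta_reg_term :: "nat \<Rightarrow> complex \<Rightarrow> complex" where
  "zeta_reg_term k s = of_nat (Suc k) powr (- s) 
     - (powr_int (ln (real (Suc (Suc k)))) s - powr_int (ln (real (Suc k))) s)"

text \<open>For Re s > 0 this is zeta(s) - 1/(s - 1), continued across s = 1; compare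
  \<open>zeta_reg_eq\<close>.\<close>

definition zeta_reg :: "complex \<Rightarrow> complex" where
  "zeta_reg s = (\<Sum>k. zeta_reg_term k s)"

lemma holomorphic_zeta_reg_term: "zeta_reg_term k holomorphic_on A"
  unfolding zeta_reg_term_def by (intro holomorphic_intros)

lemma
  shows sums_zeta_reg: "0 < Re s \<Longrightarrow> (\<lambda>k. zeta_reg_term k s) sums zeta_reg s"
    and holomorphic_zeta_reg: "zeta_reg holomorphic_on {s. 0 < Re s}"
    and sums_higher_deriv_zeta_reg:
      "0 < Re s \<Longrightarrow> (\<lambda>k. (deriv ^^ j) (zeta_reg_term k) s) sums (deriv ^^ j) zeta_reg s"
proof -
  have bound: "\<exists>h. summable h \<and> (\<forall>\<^sub>F k in sequentially. 
        \<forall>s. 0 + e < Re s \<longrightarrow> norm s < B \<longrightarrow> norm (zeta_reg_term k s) \<le> h k)" if e: "e > 0" for e B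
  proof (intro exI[of _ "\<lambda>k. B * real (Suc k) powr - (1 + e)"] conjI always_eventually allI impI)
    show "summable (\<lambda>k. B * real (Suc k) powr - (1 + e))"
      using summable_mult[OF summable_ln_power_powr[OF e, of 0]] by simp
    fix k and s :: complex assume s: "0 + e < Re s" "norm s < B"
    have "norm (zeta_reg_term k s) \<le> norm s * real (Suc k) powr - (1 + Re s)"
      unfolding zeta_reg_term_def by (rule powr_int_diff_bound) (use s e in auto)
    also have "\<dots> \<le> B * real (Suc k) powr - (1 + e)"
      using s order.trans[OF norm_ge_zero less_imp_le[OF s(2)]] by (intro mult_mono powr_mono) auto
    finally show "norm (zeta_reg_term k s) \<le> B * real (Suc k) powr - (1 + e)" .
  qed
  note * = holomorphic_series[OF holomorphic_zeta_reg_term bound]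
  have eq: "zeta_reg = (\<lambda>s. \<Sum>k. zeta_reg_term k s)"
    by (simp add: zeta_reg_def fun_eq_iff)
  show "0 < Re s \<Longrightarrow> (\<lambda>k. zeta_reg_term k s) sums zeta_reg s"
    "zeta_reg holomorphic_on {s. 0 < Re s}"
    "0 < Re s \<Longrightarrow> (\<lambda>k. (deriv ^^ j) (zeta_reg_term k) s) sums (deriv ^^ j) zeta_reg s"
    unfolding eq by (rule *; simp)+
qed

text \<open>The case m = 0 of the limit formula. At s = 1 the derivatives of the integrals
  telescope; N terms reach up to N + 1, hence \<open>ln (real (Suc N))\<close>, which is corrected
  later by \<open>ln_power_shift\<close>.\<close>

lemma higher_deriv_zeta_reg_1:
  "(\<lambda>N. complex_of_real ((\<Sum>k<N. ln (real (Suc k)) ^ p / real (Suc k)) - ln (real (Suc N)) ^ Suc p / real (Suc p)))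
     \<longlonglongrightarrow> (- 1) ^ p * (deriv ^^ p) zeta_reg 1"
proof -
  have d: "(deriv ^^ p) (zeta_reg_term k) 1 = (- 1) ^ p * of_real (ln (real (Suc k)) ^ p / real (Suc k)
    - (ln (real (Suc (Suc k))) ^ Suc p / real (Suc p) - ln (real (Suc k)) ^ Suc p / real (Suc p)))" for k
  proof -
    have "(deriv ^^ p) (zeta_reg_term k) 1 = (deriv ^^ p) (\<lambda>s. of_nat (Suc k) powr (- s)) 1 -
       ((deriv ^^ p) (powr_int (ln (real (Suc (Suc k))))) 1 - (deriv ^^ p) (powr_int (ln (real (Suc k)))) 1)"
      unfolding zeta_reg_term_def
      by (subst higher_deriv_diff[of _ UNIV], (intro holomorphic_intros; simp)+, simp, simp,
          subst higher_deriv_diff[of _ UNIV], (intro holomorphic_intros; simp)+, simp, simp, simp)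
    also have "(deriv ^^ p) (\<lambda>s. of_nat (Suc k) powr (- s)) (1 :: complex) =
         (- 1) ^ p * of_real (ln (real (Suc k)) ^ p / real (Suc k))"
      unfolding higher_deriv_of_nat_powr 
      by (simp add: power_minus[of "of_real _"] powr_minus divide_inverse del: of_nat_Suc)
    finally show ?thesis unfolding higher_deriv_powr_int_1 by (simp add: algebra_simps)
  qed
  have "(\<lambda>k. (- 1) ^ p * (deriv ^^ p) (zeta_reg_term k) 1) sums ((- 1) ^ p * (deriv ^^ p) zeta_reg 1)"
    by (intro sums_mult sums_higher_deriv_zeta_reg) simp
  moreover have "(- 1) ^ p * ((- 1) ^ p * z) = z" for z :: complex
    by (simp add: power_mult_distrib[symmetric] mult.assoc[symmetric])
  ultimately have "(\<lambda>N. \<Sum>k<N. of_real (ln (real (Suc k)) ^ p / real (Suc k)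
    - (ln (real (Suc (Suc k))) ^ Suc p / real (Suc p) - ln (real (Suc k)) ^ Suc p / real (Suc p))))
     \<longlonglongrightarrow> (- 1) ^ p * (deriv ^^ p) zeta_reg 1"
    unfolding d sums_def by simp
  moreover have "(\<Sum>k<N. ln (real (Suc k)) ^ p / real (Suc k)
    - (ln (real (Suc (Suc k))) ^ Suc p / real (Suc p) - ln (real (Suc k)) ^ Suc p / real (Suc p)))
    = (\<Sum>k<N. ln (real (Suc k)) ^ p / real (Suc k)) - ln (real (Suc N)) ^ Suc p / real (Suc p)" for N
    using sum_lessThan_telescope[of "\<lambda>k. ln (real (Suc k)) ^ Suc p / real (Suc p)" N]
    by (subst sum_subtractf) simp
  ultimately show ?thesis unfolding of_real_sum[symmetric] by (simp only:)
qed

text \<open>The subtracted integrals telescope to the integral of x^(-s) from 1 to infinity, which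
  is 1/(s - 1).\<close>

lemma zeta_reg_eq:
  assumes s: "1 < Re s"
  shows "(\<lambda>k. of_nat (Suc k) powr (- s)) sums (zeta_reg s + 1 / (s - 1))"
proof -
  have [simp]: "s \<noteq> 1" using s by auto
  have "(\<lambda>k. norm (of_nat (Suc k) powr (- (s - 1)) :: complex)) \<longlonglongrightarrow> 0"
    unfolding norm_of_nat_powr using s by (simp, real_asymp)
  hence "(\<lambda>k. of_nat (Suc k) powr (- (s - 1))) \<longlonglongrightarrow> 0"
    by (rule tendsto_norm_zero_cancel)
  hence "(\<lambda>k. powr_int (ln (real (Suc k))) s) \<longlonglongrightarrow> (1 - 0) / (s - 1)"
    unfolding powr_int_def exp_ln_powr if_not_P[OF \<open>s \<noteq> 1\<close>] by (intro tendsto_intros) simp_all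
  from telescope_sums[OF this] 
  have "(\<lambda>k. powr_int (ln (real (Suc (Suc k)))) s - powr_int (ln (real (Suc k))) s) sums (1 / (s - 1))"
    by simp
  from sums_add[OF sums_zeta_reg[of s] this] s show ?thesis
    by (simp add: zeta_reg_term_def)
qed

lemma higher_deriv_inverse_shift:
  "s \<noteq> 1 \<Longrightarrow> (deriv ^^ k) (\<lambda>s. 1 / (s - 1)) s = (- 1) ^ k * fact k / (s - 1 :: complex) ^ Suc k"
proof (induction k arbitrary: s)
  case (Suc k)
  have "deriv ((deriv ^^ k) (\<lambda>s. 1 / (s - 1))) s = deriv (\<lambda>s. (- 1) ^ k * fact k / (s - 1) ^ Suc k) s"
  proof (rule deriv_cong_ev[OF _ refl])
    have "eventually (\<lambda>w. w \<in> - {1}) (nhds s)"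
      by (rule eventually_nhds_in_open) (use Suc.prems in auto)
    thus "eventually (\<lambda>w. (deriv ^^ k) (\<lambda>s. 1 / (s - 1)) w = (- 1) ^ k * fact k / (w - 1) ^ Suc k) (nhds s)"
      by eventually_elim (use Suc.IH in simp)
  qed
  also have "\<dots> = (- 1) ^ Suc k * fact (Suc k) / (s - 1) ^ Suc (Suc k)"
  proof (rule DERIV_imp_deriv)
    have "((\<lambda>s. (s - 1) ^ Suc k) has_field_derivative of_nat (Suc k) * (s - 1) ^ k) (at s)"
      using DERIV_power[OF DERIV_diff[OF DERIV_ident DERIV_const[of 1]], of "Suc k" s UNIV] by simp
    from DERIV_cdivide[OF DERIV_inverse_fun[OF this], of "inverse ((- 1) ^ k * fact k)"] Suc.prems
    show "((\<lambda>s. (- 1) ^ k * fact k / (s - 1) ^ Suc k) has_field_derivative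
        (- 1) ^ Suc k * fact (Suc k) / (s - 1) ^ Suc (Suc k)) (at s)"
      by (simp add: divide_inverse power_inverse mult_ac)
  qed
  finally show ?case by simp
qed auto

text \<open>Both sides are (-1)^j times the j-th derivative of zeta. Differentiating 1/(s - 1)
  produces the terms from which the principal part is built.\<close>

lemma higher_deriv_zeta_reg:
  assumes s: "1 < Re s"
  shows "(\<lambda>k. of_real (ln (real (Suc k)) ^ j) * of_nat (Suc k) powr (- s)) sums 
    ((- 1) ^ j * (deriv ^^ j) zeta_reg s + fact j / (s - 1) ^ Suc j)"
proof -
  define Z where "Z s = (\<Sum>k. 1 * of_nat (Suc k) powr (- s))" for s :: complex
  let ?H = "{s. 1 < Re s}"
  note Z = dirichlet_series[of "\<lambda>_. 1" 1 0 0, folded Z_def, simplified]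
  have 1: "(deriv ^^ j) Z s = (deriv ^^ j) (\<lambda>s. zeta_reg s + 1 / (s - 1)) s"
  proof (rule higher_deriv_transform_within_open[of _ ?H])
    show "(\<lambda>s. zeta_reg s + 1 / (s - 1)) holomorphic_on ?H"
      by (intro holomorphic_intros holomorphic_on_subset[OF holomorphic_zeta_reg]) auto
    show "Z w = zeta_reg w + 1 / (w - 1)" if "w \<in> ?H" for w
      using zeta_reg_eq[of w] that by (simp add: Z_def sums_iff)
    show "Z holomorphic_on ?H" by (rule Z)
  qed (use s in \<open>auto simp: open_halfspace_Re_gt\<close>)
  also have "\<dots> = (deriv ^^ j) zeta_reg s + (deriv ^^ j) (\<lambda>s. 1 / (s - 1)) s"
    by (rule higher_deriv_add[of _ ?H])
       (use s in \<open>auto intro!: holomorphic_intros holomorphic_on_subset[OF holomorphic_zeta_reg] simp: open_halfspace_Re_gt\<close>)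
  also have "(deriv ^^ j) (\<lambda>s. 1 / (s - 1)) s = (- 1) ^ j * fact j / (s - 1) ^ Suc j"
    by (rule higher_deriv_inverse_shift) (use s in auto)
  finally have 2: "(- 1) ^ j * (deriv ^^ j) Z s = (- 1) ^ j * (deriv ^^ j) zeta_reg s + fact j / (s - 1) ^ Suc j"
    by (simp add: ring_distribs power_mult_distrib[symmetric] mult.assoc[symmetric])
  have "(\<lambda>k. (- 1) ^ j * ((- of_real (ln (real (Suc k)))) ^ j * of_nat (Suc k) powr (- s))) sums 
     ((- 1) ^ j * (deriv ^^ j) Z s)"
    by (rule sums_mult) (use Z(3)[of s j] s in simp)
  thus ?thesis unfolding 2 
    by (simp add: power_mult_distrib[symmetric] mult.assoc[symmetric] del: of_nat_Suc)
qed

section \<open>The holomorphic part at 1\<close>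

lemma ln_power_shift:
  "(\<lambda>N. ln (real (Suc N)) ^ q / c - ln (real N) ^ q / c) \<longlonglongrightarrow> 0"
proof (cases q)
  case (Suc p)
  have "(\<lambda>N. ln (real (Suc N)) ^ Suc p - ln (real N) ^ Suc p) \<longlonglongrightarrow> 0"
    by real_asymp
  from tendsto_divide[OF this tendsto_const, of c] show ?thesis
    by (cases "c = 0") (simp_all add: Suc diff_divide_distrib)
qed auto

text \<open>Both bounds are written in the shape that \<open>dirichlet_series\<close> expects, with
  d = 0 and d = 1. For the second, both bases are at most 1 + log n because gamma < 1, and they
  differ by at most 1/n.\<close>

lemma harm_dirichlet_bounds:
  shows "norm (harm (Suc k) ^ m :: complex) \<le> 1 * (1 + ln (real (Suc k))) ^ m * real (Suc k) powr - 0"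
    and "norm (complex_of_real (harm (Suc k) ^ m - (ln (real (Suc k)) + euler_mascheroni) ^ m)) 
      \<le> m * (1 + ln (real (Suc k))) ^ m * real (Suc k) powr - 1"
proof -
  have h: "0 \<le> (harm (Suc k) :: real)" "harm (Suc k) \<le> 1 + ln (real (Suc k))"
    by (simp_all add: harm_nonneg harm_le_ln del: of_nat_Suc)
  have "norm (harm (Suc k) ^ m :: complex) = harm (Suc k) ^ m"
    by (simp add: norm_power norm_harm)
  also have "\<dots> \<le> (1 + ln (real (Suc k))) ^ m" using h by (intro power_mono)
  finally show "norm (harm (Suc k) ^ m :: complex) \<le> 1 * (1 + ln (real (Suc k))) ^ m * real (Suc k) powr - 0"
    by simp
  have g: "euler_mascheroni < (1 :: real)" "euler_mascheroni > (0 :: real)"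
    using euler_mascheroni_less_13_over_22 euler_mascheroni_pos by simp_all
  have "\<bar>harm (Suc k) ^ m - (ln (real (Suc k)) + euler_mascheroni) ^ m\<bar> 
     \<le> m * (1 + ln (real (Suc k))) ^ m * \<bar>harm (Suc k) - (ln (real (Suc k)) + euler_mascheroni)\<bar>"
    using h g by (intro abs_power_diff_le) auto
  also have "\<dots> \<le> m * (1 + ln (real (Suc k))) ^ m * (1 / real (Suc k))"
    by (intro mult_left_mono harm_approx) auto
  finally show "norm (complex_of_real (harm (Suc k) ^ m - (ln (real (Suc k)) + euler_mascheroni) ^ m)) 
      \<le> m * (1 + ln (real (Suc k))) ^ m * real (Suc k) powr - 1"
    unfolding norm_of_real by (simp add: powr_minus divide_inverse)
qed

lemma
  shows sums_harm_dirichlet: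
     "1 < Re s \<Longrightarrow> (\<lambda>k. harm (Suc k) ^ m * of_nat (Suc k) powr (- s)) sums harm_dirichlet m s"
   and holomorphic_harm_dirichlet: "harm_dirichlet m holomorphic_on {s. 1 < Re s}"
  using dirichlet_series(1)[OF harm_dirichlet_bounds(1)[where m = m], of s]
    dirichlet_series(2)[OF harm_dirichlet_bounds(1)[where m = m]]
  unfolding harm_dirichlet_def[abs_def] by simp_all

text \<open>What remains of the Dirichlet series once the principal part is removed: (log n +
  gamma)^m is expanded binomially, and each derivative of zeta is replaced by that of
  \<open>zeta_reg\<close>.\<close>

definition harm_regular :: "nat \<Rightarrow> complex \<Rightarrow> complex" where
  "harm_regular m s =
     (\<Sum>k. of_real (harm (Suc k) ^ m - (ln (real (Suc k)) + euler_mascheroni) ^ m) * of_nat (Suc k) powr (- s)) +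
     (\<Sum>j=0..m. of_nat (m choose j) * euler_mascheroni ^ (m - j) * ((- 1) ^ j * (deriv ^^ j) zeta_reg s))"

lemma holomorphic_harm_regular: "harm_regular m holomorphic_on {s. 0 < Re s}"
  unfolding harm_regular_def[abs_def]
  using dirichlet_series(2)[OF harm_dirichlet_bounds(2)[where m = m]]
  by (intro holomorphic_intros holomorphic_higher_deriv holomorphic_zeta_reg open_halfspace_Re_gt) simp

text \<open>Split H_n^m into its difference from (log n + gamma)^m and that power. In the binomial
  expansion of the latter, the series of log^j n contributes the pole of order j + 1.\<close>

lemma harm_dirichlet_eq:
  assumes s: "1 < Re s"
  shows "harm_dirichlet m s = harm_regular m s + 
    (\<Sum>j=0..m. of_nat (m choose j) * (euler_mascheroni ^ (m - j) * fact j / (s - 1) ^ (j + 1)))"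
proof -
  let ?g = "euler_mascheroni :: real"
  let ?l = "\<lambda>k. ln (real (Suc k))"
  let ?p = "\<lambda>k. of_nat (Suc k) powr (- s) :: complex"
  define S1 where "S1 = (\<Sum>k. of_real (harm (Suc k) ^ m - (?l k + ?g) ^ m) * ?p k)"
  have S1: "(\<lambda>k. of_real (harm (Suc k) ^ m - (?l k + ?g) ^ m) * ?p k) sums S1"
    unfolding S1_def using dirichlet_series(1)[OF harm_dirichlet_bounds(2)[where m = m], of s] s by simp
  define S2 where "S2 = (\<Sum>j=0..m. of_nat (m choose j) * of_real ?g ^ (m - j) * 
     ((- 1) ^ j * (deriv ^^ j) zeta_reg s + fact j / (s - 1) ^ Suc j))"
  have S2: "(\<lambda>k. \<Sum>j=0..m. of_nat (m choose j) * of_real ?g ^ (m - j) * (of_real (?l k ^ j) * ?p k)) sums S2"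
    unfolding S2_def by (intro sums_sum sums_mult higher_deriv_zeta_reg s)
  have "(\<Sum>j=0..m. of_nat (m choose j) * of_real ?g ^ (m - j) * (of_real (?l k ^ j) * ?p k)) 
     = of_real ((?l k + ?g) ^ m) * ?p k" for k
    unfolding of_real_power of_real_add binomial_ring
    by (simp add: sum_distrib_left sum_distrib_right mult_ac atLeast0AtMost del: of_nat_Suc)
  with sums_add[OF S1 S2] have "(\<lambda>k. of_real (harm (Suc k) ^ m) * ?p k) sums (S1 + S2)"
    by (simp add: algebra_simps del: of_nat_Suc)
  hence "harm_dirichlet m s = S1 + S2"
    using sums_harm_dirichlet[OF s, of m] sums_unique2 
    by (simp add: of_real_harm del: of_nat_Suc)
  thus ?thesis 
    unfolding harm_regular_def S1_def S2_def by (simp add: sum.distrib ring_distribs mult_ac)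
qed

text \<open>Three limits are added: the difference series differentiated termwise, the logarithmic
  sums for each j, and the correction from log(N + 1) to log N.\<close>

lemma higher_deriv_harm_regular_1:
  "(\<lambda>N. complex_of_real ((\<Sum>k=1..N. harm k ^ m * ln (real k) ^ n / real k) -
             (\<Sum>j=0..m. real (m choose j) * euler_mascheroni ^ (m - j) *
                (ln (real N) ^ (n + j + 1) / real (n + j + 1)))))
         \<longlonglongrightarrow> (- 1) ^ n * (deriv ^^ n) (harm_regular m) 1"
proof -
  let ?g = "euler_mascheroni :: real"
  let ?l = "\<lambda>k. ln (real (Suc k))"
  let ?c = "\<lambda>j. real (m choose j) * ?g ^ (m - j)"
  let ?H = "{s. 0 < Re s}"
  define F where "F s = (\<Sum>k. of_real (harm (Suc k) ^ m - (?l k + ?g) ^ m) * of_nat (Suc k) powr (- s))" for s :: complex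
  note F = dirichlet_series(2,3)[OF harm_dirichlet_bounds(2)[where m = m], folded F_def]
  have zeta: "(deriv ^^ i) zeta_reg holomorphic_on ?H" for i
    by (intro holomorphic_higher_deriv holomorphic_zeta_reg open_halfspace_Re_gt)
  \<comment> \<open>The n-th derivative turns index j into n + j, which is where the exponents n + j
    + 1 come from.\<close>
  have dsum: "(deriv ^^ n) (\<lambda>s. \<Sum>j\<in>A. c j * (deriv ^^ j) zeta_reg s) 1 = (\<Sum>j\<in>A. c j * (deriv ^^ (n + j)) zeta_reg 1)"
    if "finite A" for A :: "nat set" and c
    using that
  proof induction
    case (insert a A)
    have "(deriv ^^ n) (\<lambda>s. c a * (deriv ^^ a) zeta_reg s + (\<Sum>j\<in>A. c j * (deriv ^^ j) zeta_reg s)) 1 = 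
       (deriv ^^ n) (\<lambda>s. c a * (deriv ^^ a) zeta_reg s) 1 + (deriv ^^ n) (\<lambda>s. \<Sum>j\<in>A. c j * (deriv ^^ j) zeta_reg s) 1"
      by (rule higher_deriv_add[of _ ?H]) (auto intro!: holomorphic_intros zeta simp: open_halfspace_Re_gt)
    also have "(deriv ^^ n) (\<lambda>s. c a * (deriv ^^ a) zeta_reg s) 1 = c a * (deriv ^^ n) ((deriv ^^ a) zeta_reg) 1"
      by (rule higher_deriv_cmult[of _ ?H]) (auto intro!: zeta simp: open_halfspace_Re_gt)
    finally show ?case using insert by (simp add: funpow_add)
  qed auto
  have "(deriv ^^ n) (harm_regular m) 1 = (deriv ^^ n) (\<lambda>s. F s + (\<Sum>j=0..m. (of_real (?c j) * (- 1) ^ j) * (deriv ^^ j) zeta_reg s)) 1"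
    unfolding harm_regular_def[abs_def] F_def by (simp add: mult.assoc)
  also have "\<dots> = (deriv ^^ n) F 1 + (deriv ^^ n) (\<lambda>s. \<Sum>j=0..m. (of_real (?c j) * (- 1) ^ j) * (deriv ^^ j) zeta_reg s) 1"
    by (rule higher_deriv_add[of _ ?H]) (auto intro!: holomorphic_intros zeta F(1)[simplified] simp: open_halfspace_Re_gt)
  also note dsum[OF finite_atLeastAtMost]
  finally have G: "(- 1) ^ n * (deriv ^^ n) (harm_regular m) 1 = (- 1) ^ n * (deriv ^^ n) F 1 +
     (\<Sum>j=0..m. of_real (?c j) * ((- 1) ^ (n + j) * (deriv ^^ (n + j)) zeta_reg 1))"
    by (simp add: ring_distribs sum_distrib_left power_add mult_ac)
  have "(\<lambda>k. (- 1) ^ n * (of_real (harm (Suc k) ^ m - (?l k + ?g) ^ m) * (- of_real (?l k)) ^ n * of_nat (Suc k) powr (- 1))) 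
     sums ((- 1) ^ n * (deriv ^^ n) F 1)"
    by (rule sums_mult) (use F(2)[of 1 n] in simp)
  moreover have "(- 1) ^ n * (of_real (harm (Suc k) ^ m - (?l k + ?g) ^ m) * (- of_real (?l k)) ^ n * of_nat (Suc k) powr (- 1))
    = complex_of_real ((harm (Suc k) ^ m - (?l k + ?g) ^ m) * ?l k ^ n / real (Suc k))" for k
    by (simp add: power_minus[of "of_real _"] powr_minus divide_inverse mult_ac del: of_nat_Suc)
  ultimately have 1: "(\<lambda>N. \<Sum>k<N. complex_of_real ((harm (Suc k) ^ m - (?l k + ?g) ^ m) * ?l k ^ n / real (Suc k))) 
     \<longlonglongrightarrow> (- 1) ^ n * (deriv ^^ n) F 1"
    unfolding sums_def by simp
  have 2: "(\<lambda>N. \<Sum>j=0..m. of_real (?c j) * complex_of_real ((\<Sum>k<N. ?l k ^ (n + j) / real (Suc k)) - 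
       ?l N ^ Suc (n + j) / real (Suc (n + j))))
    \<longlonglongrightarrow> (\<Sum>j=0..m. of_real (?c j) * ((- 1) ^ (n + j) * (deriv ^^ (n + j)) zeta_reg 1))"
    by (intro tendsto_intros higher_deriv_zeta_reg_1)
  have 3: "(\<lambda>N. complex_of_real (\<Sum>j=0..m. ?c j * (?l N ^ (n + j + 1) / real (n + j + 1) - ln (real N) ^ (n + j + 1) / real (n + j + 1))))
     \<longlonglongrightarrow> of_real (\<Sum>j=0..m. ?c j * 0)"
    by (intro tendsto_of_real tendsto_sum tendsto_mult tendsto_const ln_power_shift)
  have "(\<lambda>N. (\<Sum>k<N. complex_of_real ((harm (Suc k) ^ m - (?l k + ?g) ^ m) * ?l k ^ n / real (Suc k))) +
      (\<Sum>j=0..m. of_real (?c j) * complex_of_real ((\<Sum>k<N. ?l k ^ (n + j) / real (Suc k)) - 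
       ?l N ^ Suc (n + j) / real (Suc (n + j)))) + 
      complex_of_real (\<Sum>j=0..m. ?c j * (?l N ^ (n + j + 1) / real (n + j + 1) - ln (real N) ^ (n + j + 1) / real (n + j + 1))))
    \<longlonglongrightarrow> (- 1) ^ n * (deriv ^^ n) (harm_regular m) 1"
    using tendsto_add[OF tendsto_add[OF 1 2] 3] unfolding G by simp
  \<comment> \<open>An exact identity for every N: the binomial theorem recombines the logarithmic
    sums into (log k + gamma)^m, which cancels.\<close>
  moreover have "(\<Sum>k<N. ((harm (Suc k) ^ m - (?l k + ?g) ^ m) * ?l k ^ n / real (Suc k))) +
      (\<Sum>j=0..m. ?c j * ((\<Sum>k<N. ?l k ^ (n + j) / real (Suc k)) - ?l N ^ Suc (n + j) / real (Suc (n + j)))) + 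
      (\<Sum>j=0..m. ?c j * (?l N ^ (n + j + 1) / real (n + j + 1) - ln (real N) ^ (n + j + 1) / real (n + j + 1)))
     = (\<Sum>k=1..N. harm k ^ m * ln (real k) ^ n / real k) -
             (\<Sum>j=0..m. ?c j * (ln (real N) ^ (n + j + 1) / real (n + j + 1)))" for N
  proof -
    have "(\<Sum>j=0..m. ?c j * (\<Sum>k<N. ?l k ^ (n + j) / real (Suc k))) = 
      (\<Sum>k<N. \<Sum>j=0..m. ?c j * (?l k ^ (n + j) / real (Suc k)))"
      unfolding sum_distrib_left by (rule sum.swap)
    also have "\<dots> = (\<Sum>k<N. (?l k + ?g) ^ m * ?l k ^ n / real (Suc k))"
      unfolding binomial_ring 
      by (simp add: sum_distrib_left sum_distrib_right sum_divide_distrib mult_ac atLeast0AtMost power_add del: of_nat_Suc)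
    finally have *: "(\<Sum>j=0..m. ?c j * (\<Sum>k<N. ?l k ^ (n + j) / real (Suc k))) = 
      (\<Sum>k<N. (?l k + ?g) ^ m * ?l k ^ n / real (Suc k))" .
    have "(\<Sum>k=1..N. harm k ^ m * ln (real k) ^ n / real k) = (\<Sum>k<N. harm (Suc k) ^ m * ?l k ^ n / real (Suc k))"
      by (rule sum.reindex_bij_witness[of _ Suc "\<lambda>k. k - 1"]) auto
    thus ?thesis
      by (simp add: right_diff_distrib left_diff_distrib diff_divide_distrib sum_subtractf * del: of_nat_Suc)
  qed
  ultimately show ?thesis
    unfolding of_real_mult[symmetric] of_real_sum[symmetric] of_real_add[symmetric] by (simp only:)
qed

section \<open>Continuation to the whole plane\<close>

text \<open>In (j, i), j is the power of H_n and i the index in the binomial series. The pair (m, 0)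
  gives H_n^m n^(1-s), which belongs to the telescoping difference, and (m, 1) gives the term that
  becomes the left side of the recursion.\<close>

definition shift_index :: "nat \<Rightarrow> nat \<Rightarrow> (nat \<times> nat) set" where
  "shift_index m P = ({..m} \<times> {..<P}) - {(m, 0), (m, 1)}"

definition shift_coeff :: "nat \<Rightarrow> nat \<times> nat \<Rightarrow> complex \<Rightarrow> complex" where
  "shift_coeff m = (\<lambda>(j, i) s. of_nat (m choose j) * (- 1) ^ (m - j + i) * ((1 - s) gchoose i))"

text \<open>The product n^(1-s) n^(-(m-j)-i) is n^(-s) shifted by this amount. On
  \<open>shift_index\<close> the sum m - j + i is at least 1, so the subtraction does not
  truncate.\<close>

definition shift_amount :: "nat \<Rightarrow> nat \<times> nat \<Rightarrow> nat" where
  "shift_amount m = (\<lambda>(j, i). m - j + i - 1)"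

text \<open>The error of expanding the telescoping difference
  $H_n^m n^{1-s} - H_{n-1}^m (n-1)^{1-s}$, for $n = k + 1$, in powers of $1/n$,
  using $H_{n-1} = H_n - 1/n$. Pulling out the factor $1 - s$ of $H_n^m n^{-s}$ turns the
  telescoping sum into a recursion for the Dirichlet series.\<close>

definition shift_error :: "nat \<Rightarrow> nat \<Rightarrow> nat \<Rightarrow> complex \<Rightarrow> complex" where
  "shift_error m P k s = (1 - s) * (harm (Suc k) ^ m * of_nat (Suc k) powr (- s))
     - (\<Sum>x\<in>shift_index m P. shift_coeff m x s * 
         (harm (Suc k) ^ fst x * of_nat (Suc k) powr (- (s + of_nat (shift_amount m x)))))
     - (harm (Suc k) ^ m * of_nat (Suc k) powr (1 - s) - harm k ^ m * of_nat k powr (1 - s))"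

lemma holomorphic_gbinomial [holomorphic_intros]:
  "f holomorphic_on A \<Longrightarrow> (\<lambda>s. f s gchoose i) holomorphic_on A"
  unfolding gbinomial_prod_rev by (intro holomorphic_intros) auto

lemma holomorphic_shift_coeff [holomorphic_intros]: "shift_coeff m x holomorphic_on A"
  unfolding shift_coeff_def by (cases x) (auto intro!: holomorphic_intros)

lemma holomorphic_shift_error: "shift_error m P k holomorphic_on A"
  unfolding shift_error_def by (intro holomorphic_intros)

text \<open>The expansion of (H_n - 1/n)^m is finite and exact, so the only error comes from cutting
  off the binomial series of (1 - 1/n)^(1-s).\<close>

lemma shift_error_eq:
  assumes P: "2 \<le> P" and k: "k > 0"
  shows "shift_error m P k s = of_nat (Suc k) powr (1 - s) * harm k ^ m * 
     ((1 - of_real (1 / real (Suc k))) powr (1 - s) 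
      - (\<Sum>i<P. ((1 - s) gchoose i) * (- of_real (1 / real (Suc k))) ^ i))"
proof -
  define n where "n = complex_of_nat (Suc k)"
  define H where "H = (harm (Suc k) :: complex)"
  have n: "n \<noteq> 0" unfolding n_def using of_nat_neq_0 by blast
  have Hk: "harm k = H - 1 / n" by (simp add: H_def n_def harm_Suc inverse_eq_divide)
  let ?t = "\<lambda>x. n powr (1 - s) * (of_nat (m choose fst x) * H ^ fst x * (- 1 / n) ^ (m - fst x)) *
      (((1 - s) gchoose snd x) * (- 1 / n) ^ snd x)"
  let ?A = "{..m} \<times> {..<P}"
  have 1: "of_nat k powr (1 - s) = n powr (1 - s) * (1 - of_real (1 / real (Suc k))) powr (1 - s)"
  proof -
    have "of_nat k = n * (1 - of_real (1 / real (Suc k)))"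
      using n by (simp add: n_def field_simps)
    moreover have "(of_real (real (Suc k)) * of_real (1 - 1 / real (Suc k))) powr (1 - s) = 
       of_real (real (Suc k)) powr (1 - s) * complex_of_real (1 - 1 / real (Suc k)) powr (1 - s)"
      by (intro powr_times_real) auto
    ultimately show ?thesis by (simp add: n_def)
  qed
  have "(\<Sum>x\<in>?A. ?t x) = (\<Sum>j\<le>m. \<Sum>i<P. ?t (j, i))"
    by (simp add: sum.cartesian_product case_prod_unfold)
  also have "\<dots> = n powr (1 - s) * (\<Sum>j\<le>m. of_nat (m choose j) * H ^ j * (- 1 / n) ^ (m - j)) * 
      (\<Sum>i<P. ((1 - s) gchoose i) * (- 1 / n) ^ i)"
    unfolding sum_distrib_left[of "n powr (1 - s)"] sum_product by simp
  also have "(\<Sum>j\<le>m. of_nat (m choose j) * H ^ j * (- 1 / n) ^ (m - j)) = harm k ^ m"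
    unfolding Hk using binomial_ring[of H "- 1 / n" m] by simp
  finally have A: "(\<Sum>x\<in>?A. ?t x) = n powr (1 - s) * harm k ^ m * (\<Sum>i<P. ((1 - s) gchoose i) * (- 1 / n) ^ i)" .
  have "(\<Sum>x\<in>?A. ?t x) = (\<Sum>x\<in>shift_index m P. ?t x) + (\<Sum>x\<in>{(m, 0), (m, 1)}. ?t x)"
    unfolding shift_index_def by (rule sum.subset_diff) (use P in auto)
  also have "(\<Sum>x\<in>{(m, 0), (m, 1)}. ?t x) = n powr (1 - s) * H ^ m - (1 - s) * (H ^ m * n powr (- s))"
    using n by (simp add: powr_diff powr_minus field_simps)
  also have "(\<Sum>x\<in>shift_index m P. ?t x) = (\<Sum>x\<in>shift_index m P. shift_coeff m x s * 
         (H ^ fst x * n powr (- (s + of_nat (shift_amount m x)))))"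
  proof (intro sum.cong refl)
    fix x assume x: "x \<in> shift_index m P"
    obtain j i where [simp]: "x = (j, i)" by (cases x)
    have ji: "j \<le> m" "m - j + i \<ge> 1" using x by (auto simp: shift_index_def)
    have q: "n powr (- of_nat q) = inverse n ^ q" for q
      using n by (simp add: powr_minus power_inverse)
    have "(- 1 / n) ^ (m - j) * (- 1 / n) ^ i = ((- 1) * inverse n) ^ (m - j + i)"
      by (simp add: power_add divide_inverse)
    also have "\<dots> = (- 1) ^ (m - j + i) * n powr (- of_nat (m - j + i))"
      unfolding q by (rule power_mult_distrib)
    finally have "(- 1 / n) ^ (m - j) * (- 1 / n) ^ i = (- 1) ^ (m - j + i) * n powr (- of_nat (m - j + i))" .
    moreover have "n powr (- (s + of_nat (shift_amount m x))) = n powr (1 - s) * n powr (- of_nat (m - j + i))"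
      using ji by (simp add: shift_amount_def of_nat_diff flip: powr_add) (simp add: algebra_simps)
    ultimately show "?t x = shift_coeff m x s * (H ^ fst x * n powr (- (s + of_nat (shift_amount m x))))"
      by (simp add: shift_coeff_def mult_ac)
  qed
  finally have "(\<Sum>x\<in>shift_index m P. shift_coeff m x s * (H ^ fst x * n powr (- (s + of_nat (shift_amount m x)))))
     = n powr (1 - s) * harm k ^ m * (\<Sum>i<P. ((1 - s) gchoose i) * (- 1 / n) ^ i)
       - n powr (1 - s) * H ^ m + (1 - s) * (H ^ m * n powr (- s))"
    unfolding A by (simp add: algebra_simps)
  moreover have "- of_real (1 / real (Suc k)) = - 1 / n" by (simp add: n_def)
  ultimately show ?thesis
    unfolding shift_error_def 1 n_def[symmetric] H_def[symmetric] by (simp add: algebra_simps)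
qed

text \<open>Up to logarithms the error has size n^(1 - Re s - P), which is summable for Re s > 2 -
  P. The remainder bound requires 1/n \<le> 1/2, so the term \<open>k = 0\<close> is left out of the
  estimate.\<close>

lemma holomorphic_shift_error_sum:
  assumes P: "2 \<le> P"
  shows "\<And>s. 2 - real P < Re s \<Longrightarrow> (\<lambda>k. shift_error m P k s) sums (\<Sum>k. shift_error m P k s)"
    and "(\<lambda>s. \<Sum>k. shift_error m P k s) holomorphic_on {s. 2 - real P < Re s}"
proof -
  have bound: "\<exists>h. summable h \<and> (\<forall>\<^sub>F k in sequentially. 
        \<forall>s. 2 - real P + e < Re s \<longrightarrow> norm s < B \<longrightarrow> norm (shift_error m P k s) \<le> h k)" if e: "e > 0" for e B
  proof -
    \<comment> \<open>The exponent is 1 - s, whose norm is at most B + 1.\<close>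
    obtain C where C: "\<And>w x. norm w \<le> B + 1 \<Longrightarrow> 0 \<le> x \<Longrightarrow> x \<le> 1 / 2 \<Longrightarrow>
      norm ((1 - complex_of_real x) powr w - (\<Sum>i<P. (w gchoose i) * (- of_real x) ^ i)) \<le> C * x ^ P"
      using binomial_remainder_bound[of "B + 1" P] by blast
    define h where "h k = \<bar>C\<bar> * ((1 + ln (real (Suc k))) ^ m * real (Suc k) powr - (1 + e))" for k
    have "norm (shift_error m P k s) \<le> h k" if k: "k > 0" and s: "2 - real P + e < Re s" "norm s < B" for k s
    proof -
      let ?n = "real (Suc k)"
      have n: "1 / ?n \<le> 1 / 2" using k by (simp add: field_simps)
      have w: "norm (1 - s) \<le> B + 1"
        using norm_triangle_ineq4[of 1 s] s(2) by simp
      have "norm (harm k ^ m :: complex) \<le> (1 + ln ?n) ^ m"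
        unfolding norm_power norm_harm using harm_mono[of k "Suc k", where 'a = real] harm_le_ln[of k]
        by (intro power_mono) (auto simp: harm_nonneg)
      moreover have "norm (of_nat (Suc k) powr (1 - s) :: complex) \<le> ?n powr (real P - 1 - e)"
        unfolding norm_of_nat_powr using s by (intro powr_mono) auto
      moreover have "norm ((1 - of_real (1 / ?n)) powr (1 - s) - (\<Sum>i<P. ((1 - s) gchoose i) * (- of_real (1 / ?n)) ^ i))
        \<le> \<bar>C\<bar> * (1 / ?n) ^ P"
        by (rule order.trans[OF C[OF w _ n]]) (auto intro!: mult_right_mono)
      ultimately have "norm (shift_error m P k s) \<le> ?n powr (real P - 1 - e) * (1 + ln ?n) ^ m * (\<bar>C\<bar> * (1 / ?n) ^ P)"
        unfolding shift_error_eq[OF P k] norm_mult by (intro mult_mono) auto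
      also have "(1 / ?n) ^ P = ?n powr - real P"
        by (simp add: powr_minus powr_realpow power_divide divide_inverse power_inverse del: of_nat_Suc)
      also have "?n powr (real P - 1 - e) * (1 + ln ?n) ^ m * (\<bar>C\<bar> * ?n powr - real P) = 
         \<bar>C\<bar> * ((1 + ln ?n) ^ m * (?n powr (real P - 1 - e) * ?n powr - real P))"
        by (simp add: mult_ac)
      also have "?n powr (real P - 1 - e) * ?n powr - real P = ?n powr - (1 + e)"
        unfolding powr_add[symmetric] by (rule arg_cong[of _ _ "\<lambda>t. _ powr t"]) simp
      finally show ?thesis unfolding h_def .
    qed
    moreover have "summable h"
      unfolding h_def by (intro summable_mult summable_ln_power_powr e)
    moreover have "\<forall>\<^sub>F k in sequentially. k > (0 :: nat)"
      by (rule eventually_gt_at_top)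
    ultimately show ?thesis
      by (intro exI[of _ h] conjI) (assumption, erule eventually_mono, blast)
  qed
  show "(\<lambda>k. shift_error m P k s) sums (\<Sum>k. shift_error m P k s)" if "2 - real P < Re s" for s
    by (rule holomorphic_series(1)[OF holomorphic_shift_error bound that])
  show "(\<lambda>s. \<Sum>k. shift_error m P k s) holomorphic_on {s. 2 - real P < Re s}"
    by (rule holomorphic_series(2)[OF holomorphic_shift_error bound])
qed

text \<open>Sum the definition of \<open>shift_error\<close> over k. Shifting to the right stays in
  Re s > 1, so every series involved converges there.\<close>

lemma harm_dirichlet_recursion:
  assumes P: "2 \<le> P" and s: "1 < Re s"
  shows "(1 - s) * harm_dirichlet m s = 
    (\<Sum>x\<in>shift_index m P. shift_coeff m x s * harm_dirichlet (fst x) (s + of_nat (shift_amount m x))) 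
    + (\<Sum>k. shift_error m P k s)"
proof -
  let ?T = "\<lambda>k. harm k ^ m * of_nat k powr (1 - s) :: complex"
  have "(\<lambda>k. norm (?T (Suc k))) \<longlonglongrightarrow> 0"
  proof (rule tendsto_sandwich[OF _ _ tendsto_const])
    have "0 < Re s - 1" using s by simp
    define h where "h = (\<lambda>k. (1 + ln (real (Suc k))) ^ m * real (Suc k) powr (1 - Re s))"
    have "norm (?T (Suc k)) \<le> h k" for k
      unfolding norm_mult norm_of_nat_powr h_def using harm_dirichlet_bounds(1)[of k m]
      by (intro mult_mono) auto
    thus "\<forall>\<^sub>F k in sequentially. norm (?T (Suc k)) \<le> h k" by simp
    show "h \<longlonglongrightarrow> 0" unfolding h_def using s by real_asymp
  qed auto
  hence "(\<lambda>k. ?T (Suc k)) \<longlonglongrightarrow> 0" by (rule tendsto_norm_zero_cancel)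
  hence "?T \<longlonglongrightarrow> 0" by (rule LIMSEQ_imp_Suc)
  \<comment> \<open>The start value \<open>?T 0\<close> vanishes because
    \<open>0 powr (1 - s) = 0\<close>; this covers m = 0 as well, where
    \<open>harm 0 ^ 0 = 1\<close>.\<close>
  from telescope_sums[OF this] have t: "(\<lambda>k. ?T (Suc k) - ?T k) sums 0" 
    by simp
  have "(\<lambda>k. shift_error m P k s) sums ((1 - s) * harm_dirichlet m s -
    (\<Sum>x\<in>shift_index m P. shift_coeff m x s * harm_dirichlet (fst x) (s + of_nat (shift_amount m x))) - 0)"
    unfolding shift_error_def
    by (intro sums_diff sums_mult sums_sum sums_harm_dirichlet t) (use s in auto)
  thus ?thesis by (simp add: sums_iff)
qed

text \<open>Induction on the width K, and inside it on m, for the recursion divided by 1 - s. Terms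
  with j < m may have shift 0 and use the inner hypothesis; terms with j = m have shift at least 1
  and use the outer one.\<close>

lemma harm_dirichlet_meromorphic_extension:
  "\<exists>F. F meromorphic_on {s. 1 - real K < Re s} \<and> (\<forall>s. 1 < Re s \<longrightarrow> F s = harm_dirichlet m s)"
proof (induction K arbitrary: m)
  case 0
  show ?case
    by (intro exI[of _ "harm_dirichlet m"])
       (auto intro!: analytic_on_imp_meromorphic_on holomorphic_harm_dirichlet 
          simp: analytic_on_open open_halfspace_Re_gt)
next
  case (Suc K)
  show ?case
  proof (induction m rule: less_induct)
    case (less m)
    let ?H = "{s. 1 - real (Suc K) < Re s}"
    \<comment> \<open>Chosen so that the error series is holomorphic exactly on the target
      half-plane: 2 - P = 1 - (K + 1).\<close>
    define P where "P = K + 2"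
    have P: "2 \<le> P" "2 - real P = 1 - real (Suc K)" by (auto simp: P_def)
    have "\<exists>F. F meromorphic_on ?H \<and> (\<forall>s. 1 < Re s \<longrightarrow> F s = harm_dirichlet (fst x) (s + of_nat (shift_amount m x)))"
      if x: "x \<in> shift_index m P" for x
    proof -
      let ?g = "\<lambda>s. s + complex_of_nat (shift_amount m x)"
      obtain L F where F: "F meromorphic_on {s. 1 - real L < Re s}"
          "\<And>s. 1 < Re s \<Longrightarrow> F s = harm_dirichlet (fst x) s" and L: "Suc K \<le> L + shift_amount m x"
      proof (cases "fst x < m")
        case True
        thus ?thesis using less.IH[of "fst x"] that[of _ "Suc K"] by auto
      next
        case False
        hence "shift_amount m x \<ge> 1" using x by (auto simp: shift_index_def shift_amount_def)
        thus ?thesis using Suc.IH[of "fst x"] that[of _ K] by auto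
      qed
      from L have L': "real (Suc K) \<le> real L + real (shift_amount m x)" by linarith
      have "(\<lambda>s. F (?g s)) meromorphic_on ?H"
        by (rule meromorphic_on_compose[OF F(1)]) (use L' in \<open>auto intro!: analytic_intros\<close>)
      thus ?thesis by (intro exI[of _ "\<lambda>s. F (?g s)"]) (auto simp: F(2))
    qed
    then obtain F where F: "\<And>x. x \<in> shift_index m P \<Longrightarrow> F x meromorphic_on ?H"
       "\<And>x s. x \<in> shift_index m P \<Longrightarrow> 1 < Re s \<Longrightarrow> F x s = harm_dirichlet (fst x) (s + of_nat (shift_amount m x))"
      by metis
    define G where "G s = ((\<Sum>x\<in>shift_index m P. shift_coeff m x s * F x s) + (\<Sum>k. shift_error m P k s)) / (1 - s)" for s
    have hol: "f meromorphic_on ?H" if "f holomorphic_on ?H" for f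
      using that by (intro analytic_on_imp_meromorphic_on) (simp add: analytic_on_open open_halfspace_Re_gt)
    have "G meromorphic_on ?H"
      unfolding G_def
      by (intro meromorphic_intros F hol[OF holomorphic_shift_coeff] 
            hol[OF holomorphic_shift_error_sum(2)[OF P(1), unfolded P(2)]])
    moreover have "G s = harm_dirichlet m s" if s: "1 < Re s" for s
    proof -
      have "1 - s \<noteq> 0" using s by auto
      thus ?thesis unfolding G_def using harm_dirichlet_recursion[OF P(1) s, of m] F(2) s
        by (simp add: divide_eq_eq mult.commute)
    qed
    ultimately show ?case by blast
  qed
qed

lemma
  shows nicely_meromorphic_harm_zeta: "harm_zeta m nicely_meromorphic_on UNIV"
    and harm_zeta_eq: "1 < Re s \<Longrightarrow> harm_zeta m s = harm_dirichlet m s"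
proof -
  have "\<exists>!F. F nicely_meromorphic_on UNIV \<and> (\<forall>s. 1 < Re s \<longrightarrow> F s = harm_dirichlet m s)"
    by (rule nicely_meromorphic_extension_UNIV[OF holomorphic_harm_dirichlet harm_dirichlet_meromorphic_extension])
  from theI'[OF this, folded harm_zeta_def]
  show "harm_zeta m nicely_meromorphic_on UNIV" "1 < Re s \<Longrightarrow> harm_zeta m s = harm_dirichlet m s"
    by auto
qed

section \<open>Laurent expansion at 1 and the limit formula\<close>

theorem theorem4:
  fixes m n :: nat
  shows "(\<forall>\<^sub>F s in at 1.
            (\<lambda>i. (-1) ^ i / fact i * harm_stieltjes m i * (s - 1) ^ i) sums
              (harm_zeta m s -
                (\<Sum>j=0..m. of_nat (m choose j) *
                   (euler_mascheroni ^ (m - j) * fact j / (s - 1) ^ (j + 1)))))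
       \<and> (\<lambda>N. complex_of_real
            ((\<Sum>k=1..N. harm k ^ m * ln (real k) ^ n / real k) -
             (\<Sum>j=0..m. real (m choose j) * euler_mascheroni ^ (m - j) *
                (ln (real N) ^ (n + j + 1) / real (n + j + 1)))))
         \<longlonglongrightarrow> harm_stieltjes m n"
proof -
  let ?H = "{s. 0 < Re s}"
  define c :: "nat \<Rightarrow> complex" where "c j = of_nat (m choose j) * (euler_mascheroni ^ (m - j) * fact j)" for j
  define PP where "PP s = (\<Sum>j=0..m. c j * inverse (s - 1) ^ (j + 1))" for s
  have PP: "PP s = (\<Sum>j=0..m. of_nat (m choose j) *
                   (euler_mascheroni ^ (m - j) * fact j / (s - 1) ^ (j + 1)))" for s
    by (simp add: PP_def c_def divide_inverse power_inverse mult_ac)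
  have ev: "\<forall>\<^sub>F s in at 1. harm_zeta m s = harm_regular m s + PP s"
  proof (rule eventually_eq_meromorphic[of "harm_zeta m" ?H _ "{s. 1 < Re s}"])
    show "harm_zeta m meromorphic_on ?H"
      using nicely_meromorphic_harm_zeta[of m] unfolding nicely_meromorphic_on_def
      by (auto intro: meromorphic_on_subset)
    have "harm_regular m analytic_on ?H"
      using holomorphic_harm_regular by (simp add: analytic_on_open open_halfspace_Re_gt)
    thus "(\<lambda>s. harm_regular m s + PP s) meromorphic_on ?H"
      unfolding PP_def by (intro meromorphic_intros analytic_on_imp_meromorphic_on)
    show "connected ?H" by (intro convex_connected convex_halfspace_Re_gt)
    show "{s. 1 < Re s} \<noteq> {}" by (auto intro: exI[of _ 2])
    show "harm_zeta m z = harm_regular m z + PP z" if "z \<in> {s. 1 < Re s}" for z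
      using that harm_dirichlet_eq[of z m] harm_zeta_eq[of z m] unfolding PP by simp
  qed (auto simp: open_halfspace_Re_gt)
  have 1: "harm_regular m analytic_on {1}"
    unfolding analytic_at by (intro exI[of _ ?H]) (simp add: holomorphic_harm_regular open_halfspace_Re_gt)
  \<comment> \<open>The Laurent series at 1 is the Taylor series of \<open>harm_regular\<close> plus
    a finite sum of negative powers, so the nonnegative coefficients are Taylor
    coefficients.\<close>
  have "(\<lambda>w. harm_regular m (1 + w) + (\<Sum>j=0..m. c j * inverse w ^ (j + 1))) has_laurent_expansion
     fps_to_fls (fps_expansion (harm_regular m) 1) + (\<Sum>j=0..m. fls_const (c j) * inverse fls_X ^ (j + 1))"
    by (intro laurent_expansion_intros has_laurent_expansion_fps analytic_at_imp_has_fps_expansion 1)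
  also have "(\<lambda>w. harm_regular m (1 + w) + (\<Sum>j=0..m. c j * inverse w ^ (j + 1))) = (\<lambda>w. (\<lambda>s. harm_regular m s + PP s) (1 + w))"
    by (simp add: PP_def)
  finally have "laurent_expansion (harm_zeta m) 1 = 
     fps_to_fls (fps_expansion (harm_regular m) 1) + (\<Sum>j=0..m. fls_const (c j) * inverse fls_X ^ (j + 1))"
    using has_laurent_expansion_cong'[OF ev refl refl] by (intro laurent_expansion_eqI) simp
  moreover have "fls_nth (\<Sum>j=0..m. fls_const (c j) * inverse fls_X ^ (j + 1)) (int i) = 0" for i
    by (simp add: fls_nth_sum fls_inverse_X fls_X_inv_power_nth del: power_Suc)
  ultimately have coeff: "harm_stieltjes m i = (- 1) ^ i * (deriv ^^ i) (harm_regular m) 1" for i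
    by (simp add: harm_stieltjes_def fps_expansion_def)
  have sums: "(\<lambda>i. (- 1) ^ i / fact i * harm_stieltjes m i * (s - 1) ^ i) sums (harm_zeta m s - PP s)"
    if "harm_zeta m s = harm_regular m s + PP s" "s \<in> ball 1 1" for s
  proof -
    have "s \<in> ?H" if "s \<in> ball 1 1" for s
    proof -
      have "\<bar>1 - Re s\<bar> < 1" using that abs_Re_le_cmod[of "1 - s"] by (simp add: dist_norm)
      thus ?thesis by auto
    qed
    hence "harm_regular m holomorphic_on ball 1 1"
      by (intro holomorphic_on_subset[OF holomorphic_harm_regular]) blast
    \<comment> \<open>The unit disc about 1 lies in Re s > 0, so the Taylor series converges there
      to \<open>harm_regular\<close>.\<close>
    from holomorphic_power_series[OF this that(2)] show ?thesis
      using that(1) by (simp add: coeff mult.assoc[symmetric] power_mult_distrib[symmetric] field_simps)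
  qed
  have "\<forall>\<^sub>F s in at 1. s \<in> ball (1::complex) 1"
    by (rule eventually_at_in_open') auto
  with ev have "\<forall>\<^sub>F s in at 1. (\<lambda>i. (- 1) ^ i / fact i * harm_stieltjes m i * (s - 1) ^ i) sums (harm_zeta m s - PP s)"
    by eventually_elim (use sums in auto)
  thus ?thesis
    using higher_deriv_harm_regular_1[of m n] unfolding coeff PP by blast
qed

end
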